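(* Let $F\in C^\infty(\mathbb{R}^3,\mathbb{R})$ be such that $\sup_{(x,y)\in K,\,z\in\mathbb{R}}|\partial_zF(x,y,z)|<\infty$ for every compact $K\subset\mathbb{R}^2$. Let $f\in C^\infty(\mathbb{R})$ be strictly increasing with $f(\mathbb{R})=\mathbb{R}$ and $f'(x)\neq0$ for all $x\in\mathbb{R}$, and let $\varphi,\psi\in C^\infty(\mathbb{R})$. Let $v\in C^\infty(\mathbb{R}^2)$ be the classical solution of $$\frac{\partial^2 v}{\partial x\partial y}(x,y)=F(x,y,v(x,y)),\qquad v(x,f(x))=\varphi(x),\qquad \frac{\partial v}{\partial y}(x,f(x))=\psi(x).$$ Let $(f_\varepsilon)_{\varepsilon\in(0,1]}\in\mathcal{X}^s(\mathbb{R})$ be any family such that $[f_\varepsilon]=[f]$ in $\mathcal{G}^s(\mathbb{R})$ and such that each $f_\varepsilon$ is strictly increasing with $f_\varepsilon(\mathbb{R})=\mathbb{R}$ and $f_\varepsilon'(x)\ne0$ for all $x\in\mathbb{R}$, and let $u_\varepsilon\in C^\infty(\mathbb{R}^2)$ be the solution of the same problem with $f$ replaced by $f_\varepsilon$ (and the same $F,\varphi,\psi$). Then $v$ coincides with the generalized solution associated to $(f_\varepsilon)_\varepsilon$: $(u_\varepsilon)_\varepsilon\in\mathcal{X}^s(\mathbb{R}^2)$ and $[u_\varepsilon]=[v]$ in $\mathcal{G}^s(\mathbb{R}^2)$, i.e. $(u_\varepsilon-v)_\varepsilon\in\mathcal{N}^s(\mathbb{R}^2)$.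
   Context: For $d\in\{1,2\}$, $K\subset\mathbb{R}^d$ compact, $l\in\mathbb{N}$ and $g\in C^\infty(\mathbb{R}^d)$, put $P_{K,l}(g)=\sup_{|\alpha|\le l}\sup_{x\in K}|D^\alpha g(x)|$. The special (simplified) Colombeau algebra is $\mathcal{G}^s(\mathbb{R}^d)=\mathcal{X}^s(\mathbb{R}^d)/\mathcal{N}^s(\mathbb{R}^d)$, where $\mathcal{X}^s(\mathbb{R}^d)$ is the set of families $(u_\varepsilon)_{\varepsilon\in(0,1]}$ in $C^\infty(\mathbb{R}^d)$ such that for all compact $K$ and $l\in\mathbb{N}$ there is $p>0$ with $P_{K,l}(u_\varepsilon)=O(\varepsilon^{-p})$ as $\varepsilon\to0$, and $\mathcal{N}^s(\mathbb{R}^d)$ is the set of those such that for all compact $K$, $l\in\mathbb{N}$ and all $q>0$, $P_{K,l}(u_\varepsilon)=O(\varepsilon^{q})$ as $\varepsilon\to0$. The class of $(u_\varepsilon)_\varepsilon$ is $[u_\varepsilon]$, and $[g]$ for a single smooth $g$ is the class of the constant family $u_\varepsilon=g$. For $F$ as in the claim and a smooth strictly increasing bijection $h$ of $\mathbb{R}$ with nowhere vanishing derivative, the Cauchy problem $\partial^2w/\partial x\partial y=F(x,y,w)$, $w(x,h(x))=\varphi(x)$, $\frac{\partial w}{\partial y}(x,h(x))=\psi(x)$ with smooth $\varphi,\psi$ is known to have a unique solution $w\in C^\infty(\mathbb{R}^2)$. The generalized solution associated to $(f_\varepsilon)_\varepsilon$ is the class of the family of the corresponding solutions $u_\varepsilon$.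 *)

theory Defs
  imports "HOL-Analysis.Analysis" "HOL-Library.Landau_Symbols"
begin

section \<open>Smooth functions and partial derivatives\<close>

definition partial :: "'a::euclidean_space \<Rightarrow> ('a \<Rightarrow> real) \<Rightarrow> 'a \<Rightarrow> real" where
  "partial b g x = deriv (\<lambda>t. g (x + t *\<^sub>R b)) 0"

primrec Ck :: "nat \<Rightarrow> ('a::euclidean_space \<Rightarrow> real) \<Rightarrow> bool" where
  "Ck 0 g \<longleftrightarrow> continuous_on UNIV g"
| "Ck (Suc k) g \<longleftrightarrow> (\<forall>x. g differentiable (at x)) \<and> (\<forall>b\<in>Basis. Ck k (partial b g))"

definition smooth :: "('a::euclidean_space \<Rightarrow> real) \<Rightarrow> bool" where
  "smooth g \<longleftrightarrow> (\<forall>k. Ck k g)"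

text \<open>A multi-index is a function \<open>\<alpha>\<close> on \<open>Basis\<close> (its values elsewhere are irrelevant).
  \<open>Basis\<close> carries no order, so the partial derivatives in \<open>D\<^sup>\<alpha>\<close> are taken in the order of an
  arbitrary fixed enumeration of it; for smooth functions the order does not matter.\<close>

definition coords :: "'a::euclidean_space list" where
  "coords = (SOME bs. distinct bs \<and> set bs = Basis)"

definition multi_partial :: "('a::euclidean_space \<Rightarrow> nat) \<Rightarrow> ('a \<Rightarrow> real) \<Rightarrow> 'a \<Rightarrow> real" where
  "multi_partial \<alpha> g = foldr (\<lambda>b. partial b ^^ \<alpha> b) coords g"

text \<open>Inserting \<open>0\<close> changes the supremum only for empty \<open>K\<close>, where the supremum of the
  empty set of nonnegative numbers has to be \<open>0\<close>.\<close>

definition seminorm :: "'a::euclidean_space set \<Rightarrow> nat \<Rightarrow> ('a \<Rightarrow> real) \<Rightarrow> real" where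
  "seminorm K l g =
     Sup (insert 0 {\<bar>multi_partial \<alpha> g x\<bar> | \<alpha> x. (\<Sum>b\<in>Basis. \<alpha> b) \<le> l \<and> x \<in> K})"


section \<open>The special Colombeau algebra\<close>

text \<open>A family is a function of \<open>\<epsilon> :: real\<close> of which only the values for \<open>\<epsilon> \<in> {0<..1}\<close> matter:
  families agreeing there differ by an element of \<open>null_families\<close>.\<close>

definition moderate :: "(real \<Rightarrow> 'a::euclidean_space \<Rightarrow> real) set" where
  "moderate = {u. (\<forall>\<epsilon>\<in>{0<..1}. smooth (u \<epsilon>)) \<and>
     (\<forall>K l. compact K \<longrightarrow>
        (\<exists>p>0. (\<lambda>\<epsilon>. seminorm K l (u \<epsilon>)) \<in> O[at_right 0](\<lambda>\<epsilon>. \<epsilon> powr (- p))))}"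

definition null_families :: "(real \<Rightarrow> 'a::euclidean_space \<Rightarrow> real) set" where
  "null_families = {u. (\<forall>\<epsilon>\<in>{0<..1}. smooth (u \<epsilon>)) \<and>
     (\<forall>K l. compact K \<longrightarrow>
        (\<forall>q>0. (\<lambda>\<epsilon>. seminorm K l (u \<epsilon>)) \<in> O[at_right 0](\<lambda>\<epsilon>. \<epsilon> powr q)))}"

definition colombeau_rel ::
    "((real \<Rightarrow> 'a::euclidean_space \<Rightarrow> real) \<times> (real \<Rightarrow> 'a \<Rightarrow> real)) set" where
  "colombeau_rel = {(u, v). u \<in> moderate \<and> v \<in> moderate \<and> (\<lambda>\<epsilon> x. u \<epsilon> x - v \<epsilon> x) \<in> null_families}"

definition colombeau :: "(real \<Rightarrow> 'a::euclidean_space \<Rightarrow> real) set set" where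
  "colombeau = moderate // colombeau_rel"

definition gclass ::
    "(real \<Rightarrow> 'a::euclidean_space \<Rightarrow> real) \<Rightarrow> (real \<Rightarrow> 'a \<Rightarrow> real) set" where
  "gclass u = colombeau_rel `` {u}"

lemma gclass_in_colombeau: "u \<in> moderate \<Longrightarrow> gclass u \<in> colombeau"
  by (simp add: gclass_def colombeau_def quotientI)


section \<open>The Cauchy problem\<close>

definition admissible_curve :: "(real \<Rightarrow> real) \<Rightarrow> bool" where
  "admissible_curve h \<longleftrightarrow> smooth h \<and> strict_mono h \<and> range h = UNIV \<and> (\<forall>x. deriv h x \<noteq> 0)"

definition classical_solution ::
    "(real \<times> real \<times> real \<Rightarrow> real) \<Rightarrow> (real \<Rightarrow> real) \<Rightarrow> (real \<Rightarrow> real) \<Rightarrow> (real \<Rightarrow> real)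
      \<Rightarrow> (real \<times> real \<Rightarrow> real) \<Rightarrow> bool" where
  "classical_solution F h \<phi> \<psi> w \<longleftrightarrow> smooth w \<and>
     (\<forall>x y. partial (1, 0) (partial (0, 1) w) (x, y) = F (x, y, w (x, y))) \<and>
     (\<forall>x. w (x, h x) = \<phi> x) \<and>
     (\<forall>x. partial (0, 1) w (x, h x) = \<psi> x)"

end

theory Submission
  imports Defs
begin

text \<open>
  The difference \<open>d = u\<^sub>\<epsilon> - v\<close> solves \<open>\<partial>\<^sub>x\<partial>\<^sub>y d = F(\<cdot>, u\<^sub>\<epsilon>) - F(\<cdot>, v)\<close>, and since \<open>v\<close> has data
  \<open>\<phi>, \<psi>\<close> on the graph of \<open>f\<close>, the data of \<open>d\<close> on the graph of \<open>f\<^sub>\<epsilon>\<close> are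
  \<open>v(x, f x) - v(x, f\<^sub>\<epsilon> x)\<close> and \<open>\<partial>\<^sub>y v(x, f x) - \<partial>\<^sub>y v(x, f\<^sub>\<epsilon> x)\<close>, which are \<open>O(\<epsilon>\<^sup>q)\<close> with all
  derivatives. The right-hand side is Lipschitz in \<open>d\<close>, so a weighted sup-norm estimate on the
  rectangles \<open>[A, B] \<times> [f\<^sub>\<epsilon> A, f\<^sub>\<epsilon> B]\<close>, which are unions of characteristic triangles, gives
  \<open>d = O(\<epsilon>\<^sup>q)\<close> locally uniformly.
  Derivatives follow by induction on the order \<open>k\<close>: the bounds for \<open>d\<close> up to order \<open>k\<close> pass to
  \<open>\<partial>\<^sub>x\<partial>\<^sub>y d\<close>, and \<open>\<partial>\<^sub>x d\<close>, \<open>\<partial>\<^sub>y d\<close> are recovered up to order \<open>k\<close> by integrating from the curve.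
  There all derivatives are controlled because one of the two first partials, together with the
  tangential derivative, determines the other (\<open>f\<^sub>\<epsilon>'\<close> is locally bounded away from \<open>0\<close>).
\<close>

section \<open>Calculus of smooth functions\<close>

text \<open>\<open>partial\<close> is built on the one-dimensional \<open>deriv\<close>, which says
  little without differentiability. This bridge to the total derivative is the source of the sum,
  product, reciprocal and chain rules below.\<close>

lemma partial_eq_derivative:
  assumes "(g has_derivative D) (at x)"
  shows "partial b g x = D b"
proof -
  have "((\<lambda>t. g (x + t *\<^sub>R b)) has_derivative (\<lambda>t. D (t *\<^sub>R b))) (at 0)"
    by (rule has_derivative_compose[of "\<lambda>t. x + t *\<^sub>R b" "\<lambda>t. t *\<^sub>R b" 0 UNIV g D])
      (use assms in \<open>auto intro!: derivative_eq_intros\<close>)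
  moreover have "(\<lambda>t. D (t *\<^sub>R b)) = (*) (D b)"
    using has_derivative_linear[OF assms] by (auto simp: linear_scale)
  ultimately show ?thesis
    unfolding partial_def by (intro DERIV_imp_deriv) (simp add: has_field_derivative_def)
qed

lemma has_derivative_sum_partial:
  assumes "g differentiable (at x)"
  shows "(g has_derivative (\<lambda>h. \<Sum>c\<in>Basis. (h \<bullet> c) * partial c g x)) (at x)"
proof -
  obtain D where D: "(g has_derivative D) (at x)"
    using assms by (auto simp: differentiable_def)
  have lin: "linear D" using D by (rule has_derivative_linear)
  have "D h = (\<Sum>c\<in>Basis. (h \<bullet> c) * partial c g x)" for h
  proof -
    have "D h = D (\<Sum>c\<in>Basis. (h \<bullet> c) *\<^sub>R c)" by (simp add: euclidean_representation)
    also have "\<dots> = (\<Sum>c\<in>Basis. (h \<bullet> c) * D c)"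
      using lin by (simp add: linear_sum linear_scale)
    finally show ?thesis using partial_eq_derivative[OF D] by simp
  qed
  then have "D = (\<lambda>h. \<Sum>c\<in>Basis. (h \<bullet> c) * partial c g x)" by auto
  with D show ?thesis by simp
qed

text \<open>Taking the derivative at an arbitrary parameter \<open>s\<close> makes
  \<open>partial b g\<close> the derivative of \<open>g\<close> along a whole line, so that
  one-dimensional mean value theorems apply.\<close>

lemma has_real_derivative_partial:
  assumes "g differentiable (at (x + s *\<^sub>R b))"
  shows "((\<lambda>t. g (x + t *\<^sub>R b)) has_real_derivative partial b g (x + s *\<^sub>R b)) (at s)"
proof -
  obtain D where D: "(g has_derivative D) (at (x + s *\<^sub>R b))"
    using assms by (auto simp: differentiable_def)
  have "((\<lambda>t. g (x + t *\<^sub>R b)) has_derivative (\<lambda>t. D (t *\<^sub>R b))) (at s)"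
    by (rule has_derivative_compose[of "\<lambda>t. x + t *\<^sub>R b" "\<lambda>t. t *\<^sub>R b" s UNIV g D])
      (use D in \<open>auto intro!: derivative_eq_intros\<close>)
  moreover have "(\<lambda>t. D (t *\<^sub>R b)) = (*) (D b)"
    using has_derivative_linear[OF D] by (auto simp: linear_scale)
  ultimately show ?thesis
    using partial_eq_derivative[OF D] by (simp add: has_field_derivative_def)
qed

lemma partial_add:
  assumes "f differentiable (at x)" "g differentiable (at x)"
  shows "partial b (\<lambda>x. f x + g x) x = partial b f x + partial b g x"
proof -
  obtain D E where D: "(f has_derivative D) (at x)" and E: "(g has_derivative E) (at x)"
    using assms by (auto simp: differentiable_def)
  show ?thesis
    using partial_eq_derivative[OF has_derivative_add[OF D E], of b] partial_eq_derivative[OF D, of b]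
      partial_eq_derivative[OF E, of b] by simp
qed

lemma partial_mult:
  assumes "f differentiable (at x)" "g differentiable (at x)"
  shows "partial b (\<lambda>x. f x * g x) x = f x * partial b g x + partial b f x * g x"
proof -
  obtain D E where D: "(f has_derivative D) (at x)" and E: "(g has_derivative E) (at x)"
    using assms by (auto simp: differentiable_def)
  show ?thesis
    using partial_eq_derivative[OF has_derivative_mult[OF D E], of b] partial_eq_derivative[OF D, of b]
      partial_eq_derivative[OF E, of b] by simp
qed

lemma partial_const [simp]: "partial b (\<lambda>x. c) = (\<lambda>x. 0)"
  by (auto simp: partial_def)

lemma partial_bounded_linear: "bounded_linear g \<Longrightarrow> partial b g = (\<lambda>x. g b)"
  using partial_eq_derivative[OF bounded_linear_imp_has_derivative] by blast

text \<open>The sign is written as a factor -1 so that closure under products and constants suffices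
  in \<open>Ck_inverse\<close>.\<close>

lemma partial_inverse:
  assumes "g differentiable (at x)" "g x \<noteq> 0"
  shows "partial b (\<lambda>x. inverse (g x)) x = - 1 * (partial b g x * (inverse (g x) * inverse (g x)))"
proof -
  obtain D where D: "(g has_derivative D) (at x)"
    using assms by (auto simp: differentiable_def)
  show ?thesis
    using partial_eq_derivative[OF Deriv.has_derivative_inverse[OF assms(2) D], of b] partial_eq_derivative[OF D, of b]
    by simp
qed

text \<open>Smoothness is defined for real-valued functions only, so the inner map enters through
  its components.\<close>

lemma partial_compose:
  fixes G :: "'b::euclidean_space \<Rightarrow> real" and P :: "'a::euclidean_space \<Rightarrow> 'b"
  assumes "G differentiable (at (P x))" "\<And>c. c \<in> Basis \<Longrightarrow> (\<lambda>x. P x \<bullet> c) differentiable (at x)"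
  shows "(\<lambda>x. G (P x)) differentiable (at x)"
    "partial b (\<lambda>x. G (P x)) x = (\<Sum>c\<in>Basis. partial c G (P x) * partial b (\<lambda>x. P x \<bullet> c) x)"
proof -
  have "P differentiable (at x)"
    using assms(2) differentiable_componentwise_within by blast
  then obtain D where D: "(P has_derivative D) (at x)" by (auto simp: differentiable_def)
  have *: "((\<lambda>x. G (P x)) has_derivative (\<lambda>h. \<Sum>c\<in>Basis. (D h \<bullet> c) * partial c G (P x))) (at x)"
    by (rule has_derivative_compose[OF D has_derivative_sum_partial[OF assms(1)]])
  then show "(\<lambda>x. G (P x)) differentiable (at x)" by (auto simp: differentiable_def)
  have "partial b (\<lambda>x. P x \<bullet> c) x = D b \<bullet> c" for c
    by (rule partial_eq_derivative[OF has_derivative_inner_left[OF D]])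
  then show "partial b (\<lambda>x. G (P x)) x = (\<Sum>c\<in>Basis. partial c G (P x) * partial b (\<lambda>x. P x \<bullet> c) x)"
    using partial_eq_derivative[OF *, of b] by (simp add: mult.commute)
qed

section \<open>Stability of finite differentiability classes and of smoothness under the basic
  operations\<close>

lemma Ck_imp_continuous: "Ck k g \<Longrightarrow> continuous_on S g"
proof (cases k)
  case (Suc n)
  assume "Ck k g"
  then show ?thesis using Suc
    by (auto intro!: continuous_at_imp_continuous_on differentiable_imp_continuous_within)
qed (auto intro: continuous_on_subset)

lemma Ck_SucD: "Ck (Suc k) g \<Longrightarrow> Ck k g"
proof (induction k arbitrary: g)
  case 0
  then show ?case using Ck_imp_continuous[OF 0] by simp
next
  case (Suc k)
  then show ?case by (metis Ck.simps(2))
qed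

lemma Ck_add: "Ck k f \<Longrightarrow> Ck k g \<Longrightarrow> Ck k (\<lambda>x. f x + g x)"
proof (induction k arbitrary: f g)
  case (Suc k)
  then have "partial b (\<lambda>x. f x + g x) = (\<lambda>x. partial b f x + partial b g x)" for b
    by (auto simp: partial_add)
  then show ?case using Suc by auto
qed (auto intro: continuous_intros)

lemma Ck_const: "Ck k (\<lambda>x. c)"
  by (induction k arbitrary: c) auto

lemma Ck_sum:
  assumes "\<And>i. i \<in> I \<Longrightarrow> Ck k (f i)"
  shows "Ck k (\<lambda>x. \<Sum>i\<in>I. f i x)"
  using assms by (induction I rule: infinite_finite_induct) (auto intro: Ck_const Ck_add)

lemma Ck_mult: "Ck k f \<Longrightarrow> Ck k g \<Longrightarrow> Ck k (\<lambda>x. f x * g x)"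
proof (induction k arbitrary: f g)
  case (Suc k)
  then have "partial b (\<lambda>x. f x * g x) = (\<lambda>x. f x * partial b g x + partial b f x * g x)" for b
    by (auto simp: partial_mult)
  moreover have "Ck k (\<lambda>x. f x * partial b g x + partial b f x * g x)" if "b \<in> Basis" for b
    using Suc.prems that Ck_SucD[OF Suc.prems(1)] Ck_SucD[OF Suc.prems(2)]
    by (intro Ck_add Suc.IH) simp_all
  ultimately show ?case using Suc.prems by simp
qed (auto intro: continuous_intros)

text \<open>The chain rule leaves partials of \<open>G\<close> composed with the same
  \<open>P\<close>; hence the induction varies \<open>G\<close> and keeps \<open>P\<close>
  fixed.\<close>

lemma Ck_compose:
  fixes P :: "'a::euclidean_space \<Rightarrow> 'b::euclidean_space"
  assumes "Ck k G" "\<And>c. c \<in> Basis \<Longrightarrow> Ck k (\<lambda>x. P x \<bullet> c)"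
  shows "Ck k (\<lambda>x. G (P x))"
  using assms
proof (induction k arbitrary: G)
  case 0
  then have "continuous_on UNIV P" using continuous_on_componentwise by force
  with 0 show ?case by (auto intro: continuous_on_compose2)
next
  case (Suc k)
  have *: "partial b (\<lambda>x. G (P x)) = (\<lambda>x. \<Sum>c\<in>Basis. partial c G (P x) * partial b (\<lambda>x. P x \<bullet> c) x)" for b
    using partial_compose(2)[of G P] Suc.prems by auto
  have "Ck k (\<lambda>x. partial c G (P x))" if "c \<in> Basis" for c
  proof (rule Suc.IH)
    show "Ck k (partial c G)" using Suc.prems(1) that by simp
    show "Ck k (\<lambda>x. P x \<bullet> c)" if "c \<in> Basis" for c
      by (rule Ck_SucD[OF Suc.prems(2)[OF that]])
  qed
  then have "Ck k (\<lambda>x. \<Sum>c\<in>Basis. partial c G (P x) * partial b (\<lambda>x. P x \<bullet> c) x)" if "b \<in> Basis" for b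
    using Suc.prems that by (intro Ck_sum Ck_mult) simp_all
  moreover have "(\<lambda>x. G (P x)) differentiable (at x)" for x
    by (rule partial_compose(1)) (use Suc.prems in simp_all)
  ultimately show ?case by (simp add: *)
qed

text \<open>A partial of the reciprocal is a product of a partial of \<open>g\<close> and the
  reciprocal itself, one order lower, which closes the induction.\<close>

lemma Ck_inverse: "Ck k g \<Longrightarrow> (\<And>x. g x \<noteq> 0) \<Longrightarrow> Ck k (\<lambda>x. inverse (g x))"
proof (induction k)
  case (Suc k)
  have "partial b (\<lambda>x. inverse (g x))
      = (\<lambda>x. - 1 * (partial b g x * (inverse (g x) * inverse (g x))))" for b
    using Suc.prems partial_inverse[of g _ b] by auto
  moreover have "Ck k (\<lambda>x. - 1 * (partial b g x * (inverse (g x) * inverse (g x))))" if "b \<in> Basis" for b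
    using Suc Ck_SucD[OF Suc.prems(1)] that by (intro Ck_mult Ck_const) simp_all
  ultimately show ?case using Suc.prems by simp
qed (auto intro: continuous_intros)

lemma Ck_bounded_linear:
  fixes g :: "'a::euclidean_space \<Rightarrow> real"
  assumes "bounded_linear g"
  shows "Ck k g"
  using assms by (cases k) (auto simp: partial_bounded_linear Ck_const
    intro: bounded_linear.linear linear_continuous_on bounded_linear_imp_differentiable)

lemma smooth_add: "smooth f \<Longrightarrow> smooth g \<Longrightarrow> smooth (\<lambda>x. f x + g x)"
  by (simp add: smooth_def Ck_add)

lemma smooth_mult: "smooth f \<Longrightarrow> smooth g \<Longrightarrow> smooth (\<lambda>x. f x * g x)"
  by (simp add: smooth_def Ck_mult)

lemma smooth_const: "smooth (\<lambda>x. c)"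
  by (simp add: smooth_def Ck_const)

lemma smooth_diff: "smooth f \<Longrightarrow> smooth g \<Longrightarrow> smooth (\<lambda>x. f x - g x)"
  using smooth_add[of f "\<lambda>x. -1 * g x"] smooth_mult[OF smooth_const[of "-1"], of g] by simp

lemma smooth_compose:
  "smooth G \<Longrightarrow> (\<And>c. c \<in> Basis \<Longrightarrow> smooth (\<lambda>x. P x \<bullet> c)) \<Longrightarrow> smooth (\<lambda>x. G (P x))"
  by (simp add: smooth_def Ck_compose)

lemma smooth_inverse: "smooth g \<Longrightarrow> (\<And>x. g x \<noteq> 0) \<Longrightarrow> smooth (\<lambda>x. inverse (g x))"
  by (simp add: smooth_def Ck_inverse)

lemma smooth_bounded_linear: "bounded_linear g \<Longrightarrow> smooth g"
  by (simp add: smooth_def Ck_bounded_linear)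

lemma smooth_partial: "smooth g \<Longrightarrow> b \<in> Basis \<Longrightarrow> smooth (partial b g)"
  unfolding smooth_def by (metis Ck.simps(2))

lemma smooth_differentiable: "smooth g \<Longrightarrow> g differentiable (at x)"
  unfolding smooth_def by (metis Ck.simps(2))

lemma smooth_continuous: "smooth g \<Longrightarrow> continuous_on S g"
  unfolding smooth_def using Ck_imp_continuous by blast

lemma partial_diff_smooth:
  assumes "smooth f" "smooth g"
  shows "partial b (\<lambda>x. f x - g x) = (\<lambda>x. partial b f x - partial b g x)"
proof
  fix x
  obtain D E where D: "(f has_derivative D) (at x)" and E: "(g has_derivative E) (at x)"
    using assms smooth_differentiable unfolding differentiable_def by blast
  show "partial b (\<lambda>x. f x - g x) x = partial b f x - partial b g x"
    using partial_eq_derivative[OF has_derivative_diff[OF D E], of b] partial_eq_derivative[OF D, of b]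
      partial_eq_derivative[OF E, of b] by simp
qed

section \<open>Symmetry of second partial derivatives\<close>

lemma second_difference:
  assumes g: "smooth g" and b: "b \<in> Basis" and c: "c \<in> Basis" and s: "0 < s"
  obtains \<sigma> \<tau> where "0 < \<sigma>" "\<sigma> < s" "0 < \<tau>" "\<tau> < s"
    "g (x + s *\<^sub>R b + s *\<^sub>R c) - g (x + s *\<^sub>R b) - g (x + s *\<^sub>R c) + g x
      = s * s * partial c (partial b g) (x + \<sigma> *\<^sub>R b + \<tau> *\<^sub>R c)"
proof -
  \<comment> \<open>Two applications of the mean value theorem: first in direction \<open>b\<close>
    to the gap \<open>k\<close> between two parallel segments, then in direction \<open>c\<close> to
    the partial in direction \<open>b\<close>.\<close>
  define k where "k = (\<lambda>t. g (x + s *\<^sub>R c + t *\<^sub>R b) - g (x + t *\<^sub>R b))"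
  have "(k has_real_derivative partial b g (x + s *\<^sub>R c + t *\<^sub>R b) - partial b g (x + t *\<^sub>R b)) (at t)" for t
    unfolding k_def by (intro DERIV_diff has_real_derivative_partial smooth_differentiable g)
  then obtain \<sigma> where \<sigma>: "0 < \<sigma>" "\<sigma> < s"
      and 1: "k s - k 0 = s * (partial b g (x + s *\<^sub>R c + \<sigma> *\<^sub>R b) - partial b g (x + \<sigma> *\<^sub>R b))"
    using MVT2[OF s, of k "\<lambda>t. partial b g (x + s *\<^sub>R c + t *\<^sub>R b) - partial b g (x + t *\<^sub>R b)"] by auto
  define m where "m = (\<lambda>t. partial b g (x + \<sigma> *\<^sub>R b + t *\<^sub>R c))"
  have "(m has_real_derivative partial c (partial b g) (x + \<sigma> *\<^sub>R b + t *\<^sub>R c)) (at t)" for t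
    unfolding m_def by (intro has_real_derivative_partial smooth_differentiable smooth_partial g b)
  then obtain \<tau> where \<tau>: "0 < \<tau>" "\<tau> < s"
      and 2: "m s - m 0 = s * partial c (partial b g) (x + \<sigma> *\<^sub>R b + \<tau> *\<^sub>R c)"
    using MVT2[OF s, of m "\<lambda>t. partial c (partial b g) (x + \<sigma> *\<^sub>R b + t *\<^sub>R c)"] by auto
  show ?thesis
    by (rule that[OF \<sigma> \<tau>]) (use 1 2 in \<open>simp add: k_def m_def algebra_simps\<close>)
qed

text \<open>The second difference is symmetric in \<open>b\<close> and \<open>c\<close>. Divided by
  \<open>s * s\<close> it equals either mixed partial at some point near \<open>x\<close>, so
  continuity of the mixed partials identifies the two limits.\<close>

theorem partial_commute:
  assumes g: "smooth g" and b: "b \<in> Basis" and c: "c \<in> Basis"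
  shows "partial b (partial c g) = partial c (partial b g)"
proof
  fix x
  have lim: "((\<lambda>s. h (x + \<sigma> s *\<^sub>R b + \<tau> s *\<^sub>R c)) \<longlongrightarrow> h x) (at_right 0)"
    if h: "continuous_on UNIV h" and *: "\<And>s. 0 < s \<Longrightarrow> 0 < \<sigma> s \<and> \<sigma> s < s \<and> 0 < \<tau> s \<and> \<tau> s < s"
    for h :: "'a \<Rightarrow> real" and \<sigma> \<tau> :: "real \<Rightarrow> real"
  proof -
    have id: "((\<lambda>s::real. s) \<longlongrightarrow> 0) (at_right 0)" by (simp add: tendsto_ident_at)
    have "(\<sigma> \<longlongrightarrow> 0) (at_right 0)" "(\<tau> \<longlongrightarrow> 0) (at_right 0)"
      by (rule tendsto_sandwich[OF _ _ tendsto_const id];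
          use * in \<open>force simp: eventually_at_right_field intro: exI[of _ 1]\<close>)+
    then have "((\<lambda>s. x + \<sigma> s *\<^sub>R b + \<tau> s *\<^sub>R c) \<longlongrightarrow> x + 0 *\<^sub>R b + 0 *\<^sub>R c) (at_right 0)"
      by (intro tendsto_intros)
    then show ?thesis
      using continuous_on_tendsto_compose[OF h, of _ x] by simp
  qed
  have "\<forall>s. \<exists>\<sigma> \<tau>. 0 < s \<longrightarrow> (0 < \<sigma> \<and> \<sigma> < s \<and> 0 < \<tau> \<and> \<tau> < s \<and>
    g (x + s *\<^sub>R b + s *\<^sub>R c) - g (x + s *\<^sub>R b) - g (x + s *\<^sub>R c) + g x
      = s * s * partial c (partial b g) (x + \<sigma> *\<^sub>R b + \<tau> *\<^sub>R c))"
    using second_difference[OF g b c] by metis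
  then obtain \<sigma> \<tau> where 1: "\<And>s::real. 0 < s \<Longrightarrow> 0 < \<sigma> s \<and> \<sigma> s < s \<and> 0 < \<tau> s \<and> \<tau> s < s \<and>
    g (x + s *\<^sub>R b + s *\<^sub>R c) - g (x + s *\<^sub>R b) - g (x + s *\<^sub>R c) + g x
      = s * s * partial c (partial b g) (x + \<sigma> s *\<^sub>R b + \<tau> s *\<^sub>R c)"
    by metis
  have "\<forall>s. \<exists>\<sigma> \<tau>. 0 < s \<longrightarrow> (0 < \<sigma> \<and> \<sigma> < s \<and> 0 < \<tau> \<and> \<tau> < s \<and>
    g (x + s *\<^sub>R c + s *\<^sub>R b) - g (x + s *\<^sub>R c) - g (x + s *\<^sub>R b) + g x
      = s * s * partial b (partial c g) (x + \<sigma> *\<^sub>R c + \<tau> *\<^sub>R b))"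
    using second_difference[OF g c b] by metis
  then obtain \<sigma>' \<tau>' where 2: "\<And>s::real. 0 < s \<Longrightarrow> 0 < \<sigma>' s \<and> \<sigma>' s < s \<and> 0 < \<tau>' s \<and> \<tau>' s < s \<and>
    g (x + s *\<^sub>R c + s *\<^sub>R b) - g (x + s *\<^sub>R c) - g (x + s *\<^sub>R b) + g x
      = s * s * partial b (partial c g) (x + \<sigma>' s *\<^sub>R c + \<tau>' s *\<^sub>R b)"
    by metis
  \<comment> \<open>The second pair of intermediate points is reordered to displace along
    \<open>b\<close> first, so that \<open>lim\<close> serves both sides.\<close>
  have "partial c (partial b g) (x + \<sigma> s *\<^sub>R b + \<tau> s *\<^sub>R c)
      = partial b (partial c g) (x + \<tau>' s *\<^sub>R b + \<sigma>' s *\<^sub>R c)" if "0 < s" for s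
  proof -
    have "s * s * partial c (partial b g) (x + \<sigma> s *\<^sub>R b + \<tau> s *\<^sub>R c)
        = s * s * partial b (partial c g) (x + \<sigma>' s *\<^sub>R c + \<tau>' s *\<^sub>R b)"
    proof -
      have "g (x + s *\<^sub>R b + s *\<^sub>R c) = g (x + s *\<^sub>R c + s *\<^sub>R b)"
        by (simp add: algebra_simps)
      then show ?thesis using 1[OF that] 2[OF that] by linarith
    qed
    then show ?thesis using that by (simp add: add.commute add.left_commute)
  qed
  then have ev: "\<forall>\<^sub>F s in at_right 0. partial c (partial b g) (x + \<sigma> s *\<^sub>R b + \<tau> s *\<^sub>R c)
      = partial b (partial c g) (x + \<tau>' s *\<^sub>R b + \<sigma>' s *\<^sub>R c)"
    by (auto simp: eventually_at_right_field intro: exI[of _ 1])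
  have "((\<lambda>s. partial c (partial b g) (x + \<sigma> s *\<^sub>R b + \<tau> s *\<^sub>R c)) \<longlongrightarrow> partial c (partial b g) x) (at_right 0)"
    using 1 by (intro lim[of "partial c (partial b g)"] smooth_continuous smooth_partial g b c) simp_all
  moreover have "((\<lambda>s. partial b (partial c g) (x + \<tau>' s *\<^sub>R b + \<sigma>' s *\<^sub>R c)) \<longlongrightarrow> partial b (partial c g) x) (at_right 0)"
    using 2 by (intro lim[of "partial b (partial c g)"] smooth_continuous smooth_partial g b c) simp_all
  ultimately show "partial b (partial c g) x = partial c (partial b g) x"
    using tendsto_unique[OF trivial_limit_at_right_real] tendsto_cong[OF ev] by blast
qed

section \<open>Families of locally uniform order\<close>

text \<open>The case \<open>q = 0\<close> is local boundedness uniformly in small \<epsilon>; it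
  describes the admissible coefficients and inner maps. The range of small \<epsilon> may depend on
  \<open>K\<close>.\<close>

definition locally_O :: "real \<Rightarrow> (real \<Rightarrow> 'a::euclidean_space \<Rightarrow> real) \<Rightarrow> bool" where
  "locally_O q g \<longleftrightarrow> (\<forall>K. compact K \<longrightarrow>
     (\<exists>C. \<forall>\<^sub>F \<epsilon> in at_right 0. \<forall>x\<in>K. \<bar>g \<epsilon> x\<bar> \<le> C * \<epsilon> powr q))"

text \<open>The recursion mirrors \<open>Ck\<close> and covers derivatives in every order of
  differentiation, so that product and chain rules are proved by induction on \<open>k\<close>
  without multi-indices.\<close>

primrec derivs_O :: "nat \<Rightarrow> real \<Rightarrow> (real \<Rightarrow> 'a::euclidean_space \<Rightarrow> real) \<Rightarrow> bool" where
  "derivs_O 0 q g \<longleftrightarrow> (\<forall>\<epsilon>\<in>{0<..1}. smooth (g \<epsilon>)) \<and> locally_O q g"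
| "derivs_O (Suc k) q g \<longleftrightarrow> (\<forall>\<epsilon>\<in>{0<..1}. smooth (g \<epsilon>)) \<and> locally_O q g \<and>
     (\<forall>b\<in>Basis. derivs_O k q (\<lambda>\<epsilon>. partial b (g \<epsilon>)))"

section \<open>Algebraic operations on families\<close>

lemma eventually_unit_interval: "\<forall>\<^sub>F \<epsilon>::real in at_right 0. \<epsilon> \<in> {0<..1}"
  by (auto simp: eventually_at_right_field intro: exI[of _ 1])

text \<open>A positive constant allows monotone multiplication by it and thresholds such as
  1/\<open>C\<close> for \<epsilon>.\<close>

lemma locally_OD:
  assumes "locally_O q g" "compact K"
  obtains C where "0 < C" "\<forall>\<^sub>F \<epsilon> in at_right 0. \<forall>x\<in>K. \<bar>g \<epsilon> x\<bar> \<le> C * \<epsilon> powr q"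
proof -
  obtain C where C: "\<forall>\<^sub>F \<epsilon> in at_right 0. \<forall>x\<in>K. \<bar>g \<epsilon> x\<bar> \<le> C * \<epsilon> powr q"
    using assms unfolding locally_O_def by blast
  have "C * \<epsilon> powr q \<le> (\<bar>C\<bar> + 1) * \<epsilon> powr q" for \<epsilon>
    by (intro mult_right_mono) auto
  then show ?thesis
    by (intro that[of "\<bar>C\<bar> + 1"] eventually_mono[OF C]) (auto intro: order_trans)
qed

lemma locally_O_cong:
  assumes "locally_O q f" "\<And>\<epsilon> x. \<epsilon> \<in> {0<..1} \<Longrightarrow> f \<epsilon> x = g \<epsilon> x"
  shows "locally_O q g"
  unfolding locally_O_def
proof (intro allI impI)
  fix K :: "'a set"
  assume "compact K"
  then obtain C where C: "\<forall>\<^sub>F \<epsilon> in at_right 0. \<forall>x\<in>K. \<bar>f \<epsilon> x\<bar> \<le> C * \<epsilon> powr q"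
    using assms(1) unfolding locally_O_def by blast
  have "\<forall>\<^sub>F \<epsilon> in at_right 0. \<forall>x\<in>K. \<bar>g \<epsilon> x\<bar> \<le> C * \<epsilon> powr q"
    using C eventually_unit_interval by eventually_elim (use assms(2) in auto)
  then show "\<exists>C. \<forall>\<^sub>F \<epsilon> in at_right 0. \<forall>x\<in>K. \<bar>g \<epsilon> x\<bar> \<le> C * \<epsilon> powr q" by blast
qed

lemma locally_O_add:
  assumes "locally_O q f" "locally_O q g"
  shows "locally_O q (\<lambda>\<epsilon> x. f \<epsilon> x + g \<epsilon> x)"
  unfolding locally_O_def
proof (intro allI impI)
  fix K :: "'a set"
  assume K: "compact K"
  obtain C where C: "\<forall>\<^sub>F \<epsilon> in at_right 0. \<forall>x\<in>K. \<bar>f \<epsilon> x\<bar> \<le> C * \<epsilon> powr q"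
    by (rule locally_OD[OF assms(1) K])
  obtain D where D: "\<forall>\<^sub>F \<epsilon> in at_right 0. \<forall>x\<in>K. \<bar>g \<epsilon> x\<bar> \<le> D * \<epsilon> powr q"
    by (rule locally_OD[OF assms(2) K])
  have "\<forall>\<^sub>F \<epsilon> in at_right 0. \<forall>x\<in>K. \<bar>f \<epsilon> x + g \<epsilon> x\<bar> \<le> (C + D) * \<epsilon> powr q"
    using C D
  proof eventually_elim
    case (elim \<epsilon>)
    show ?case
    proof
      fix x assume "x \<in> K"
      with elim have "\<bar>f \<epsilon> x\<bar> \<le> C * \<epsilon> powr q" "\<bar>g \<epsilon> x\<bar> \<le> D * \<epsilon> powr q" by auto
      then show "\<bar>f \<epsilon> x + g \<epsilon> x\<bar> \<le> (C + D) * \<epsilon> powr q" by (simp add: distrib_right)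
    qed
  qed
  then show "\<exists>C. \<forall>\<^sub>F \<epsilon> in at_right 0. \<forall>x\<in>K. \<bar>f \<epsilon> x + g \<epsilon> x\<bar> \<le> C * \<epsilon> powr q" by blast
qed

lemma locally_O_mult:
  assumes "locally_O p f" "locally_O q g"
  shows "locally_O (p + q) (\<lambda>\<epsilon> x. f \<epsilon> x * g \<epsilon> x)"
  unfolding locally_O_def
proof (intro allI impI)
  fix K :: "'a set"
  assume K: "compact K"
  obtain C where C: "\<forall>\<^sub>F \<epsilon> in at_right 0. \<forall>x\<in>K. \<bar>f \<epsilon> x\<bar> \<le> C * \<epsilon> powr p"
    by (rule locally_OD[OF assms(1) K])
  obtain D where D: "\<forall>\<^sub>F \<epsilon> in at_right 0. \<forall>x\<in>K. \<bar>g \<epsilon> x\<bar> \<le> D * \<epsilon> powr q"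
    by (rule locally_OD[OF assms(2) K])
  have "\<forall>\<^sub>F \<epsilon> in at_right 0. \<forall>x\<in>K. \<bar>f \<epsilon> x * g \<epsilon> x\<bar> \<le> (C * D) * \<epsilon> powr (p + q)"
    using C D
  proof eventually_elim
    case (elim \<epsilon>)
    show ?case
    proof
      fix x assume "x \<in> K"
      with elim have "\<bar>f \<epsilon> x\<bar> \<le> C * \<epsilon> powr p" "\<bar>g \<epsilon> x\<bar> \<le> D * \<epsilon> powr q" by auto
      then have "\<bar>f \<epsilon> x\<bar> * \<bar>g \<epsilon> x\<bar> \<le> (C * \<epsilon> powr p) * (D * \<epsilon> powr q)"
        by (intro mult_mono) (auto intro: order_trans[OF abs_ge_zero])
      then show "\<bar>f \<epsilon> x * g \<epsilon> x\<bar> \<le> (C * D) * \<epsilon> powr (p + q)"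
        by (simp add: abs_mult powr_add mult_ac)
    qed
  qed
  then show "\<exists>C. \<forall>\<^sub>F \<epsilon> in at_right 0. \<forall>x\<in>K. \<bar>f \<epsilon> x * g \<epsilon> x\<bar> \<le> C * \<epsilon> powr (p + q)" by blast
qed

lemma locally_O_antimono:
  assumes "locally_O q f" "p \<le> q"
  shows "locally_O p f"
  unfolding locally_O_def
proof (intro allI impI)
  fix K :: "'a set"
  assume K: "compact K"
  obtain C where C0: "0 < C" and C: "\<forall>\<^sub>F \<epsilon> in at_right 0. \<forall>x\<in>K. \<bar>f \<epsilon> x\<bar> \<le> C * \<epsilon> powr q"
    by (rule locally_OD[OF assms(1) K])
  have "\<forall>\<^sub>F \<epsilon> in at_right 0. \<forall>x\<in>K. \<bar>f \<epsilon> x\<bar> \<le> C * \<epsilon> powr p"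
    using C eventually_unit_interval
  proof eventually_elim
    case (elim \<epsilon>)
    have "\<epsilon> powr q \<le> \<epsilon> powr p" using elim assms(2) by (intro powr_mono') auto
    then have "C * \<epsilon> powr q \<le> C * \<epsilon> powr p" using C0 by simp
    with elim show ?case by (meson order_trans)
  qed
  then show "\<exists>C. \<forall>\<^sub>F \<epsilon> in at_right 0. \<forall>x\<in>K. \<bar>f \<epsilon> x\<bar> \<le> C * \<epsilon> powr p" by blast
qed

lemma locally_O_fixed:
  assumes "continuous_on UNIV g"
  shows "locally_O 0 (\<lambda>_. g)"
  unfolding locally_O_def
proof (intro allI impI)
  fix K :: "'a set"
  assume "compact K"
  then have "compact (g ` K)"
    using assms by (intro compact_continuous_image) (auto intro: continuous_on_subset)
  then obtain C where "\<forall>x\<in>K. \<bar>g x\<bar> \<le> C"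
    by (auto dest!: compact_imp_bounded simp: bounded_iff)
  then have "\<forall>\<^sub>F \<epsilon> in at_right 0. \<forall>x\<in>K. \<bar>g x\<bar> \<le> C * \<epsilon> powr 0"
    by (intro eventually_mono[OF eventually_unit_interval]) simp
  then show "\<exists>C. \<forall>\<^sub>F \<epsilon> in at_right 0. \<forall>x\<in>K. \<bar>g x\<bar> \<le> C * \<epsilon> powr 0" by blast
qed

lemma derivs_O_smooth: "derivs_O k q g \<Longrightarrow> \<epsilon> \<in> {0<..1} \<Longrightarrow> smooth (g \<epsilon>)"
  by (cases k) auto

lemma derivs_O_locally: "derivs_O k q g \<Longrightarrow> locally_O q g"
  by (cases k) auto

text \<open>Rules for \<open>partial\<close> need smoothness, which families provide only for
  \<epsilon> in the unit interval; identities of derivatives are therefore required only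
  there.\<close>

lemma derivs_O_cong:
  assumes "derivs_O k q f" "\<And>\<epsilon>. \<epsilon> \<in> {0<..1} \<Longrightarrow> f \<epsilon> = g \<epsilon>"
  shows "derivs_O k q g"
  using assms
proof (induction k arbitrary: f g)
  case (Suc k)
  have "derivs_O k q (\<lambda>\<epsilon>. partial b (g \<epsilon>))" if "b \<in> Basis" for b
    by (rule Suc.IH[of "\<lambda>\<epsilon>. partial b (f \<epsilon>)"]) (use Suc.prems that in auto)
  then show ?case using Suc.prems by (auto intro: locally_O_cong)
qed (auto intro: locally_O_cong)

lemma derivs_O_SucD: "derivs_O (Suc k) q g \<Longrightarrow> derivs_O k q g"
  by (induction k arbitrary: g) auto

lemma derivs_O_partial: "derivs_O (Suc k) q g \<Longrightarrow> b \<in> Basis \<Longrightarrow> derivs_O k q (\<lambda>\<epsilon>. partial b (g \<epsilon>))"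
  by simp

lemma derivs_O_antimono: "derivs_O k q g \<Longrightarrow> p \<le> q \<Longrightarrow> derivs_O k p g"
  by (induction k arbitrary: g) (auto intro: locally_O_antimono)

lemma derivs_O_add:
  assumes "derivs_O k q f" "derivs_O k q g"
  shows "derivs_O k q (\<lambda>\<epsilon> x. f \<epsilon> x + g \<epsilon> x)"
  using assms
proof (induction k arbitrary: f g)
  case (Suc k)
  have "derivs_O k q (\<lambda>\<epsilon>. partial b (\<lambda>x. f \<epsilon> x + g \<epsilon> x))" if "b \<in> Basis" for b
  proof (rule derivs_O_cong)
    show "derivs_O k q (\<lambda>\<epsilon> x. partial b (f \<epsilon>) x + partial b (g \<epsilon>) x)"
      using Suc.prems that by (intro Suc.IH derivs_O_partial)
    show "(\<lambda>x. partial b (f \<epsilon>) x + partial b (g \<epsilon>) x) = partial b (\<lambda>x. f \<epsilon> x + g \<epsilon> x)"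
      if "\<epsilon> \<in> {0<..1}" for \<epsilon>
      using Suc.prems that by (auto simp: partial_add smooth_differentiable)
  qed
  then show ?case using Suc.prems by (auto intro: locally_O_add smooth_add)
qed (auto intro: locally_O_add smooth_add)

lemma derivs_O_fixed: "smooth g \<Longrightarrow> derivs_O k 0 (\<lambda>_. g)"
  by (induction k arbitrary: g) (auto intro: locally_O_fixed smooth_continuous smooth_partial)

lemma derivs_O_zero: "derivs_O k q (\<lambda>_ _. 0)"
proof -
  have "locally_O q (\<lambda>_ _. 0 :: real)"
    unfolding locally_O_def by (auto intro: exI[of _ 0])
  then show ?thesis
    by (induction k) (auto intro: smooth_const)
qed

lemma derivs_O_sum:
  assumes "\<And>i. i \<in> I \<Longrightarrow> derivs_O k q (f i)"
  shows "derivs_O k q (\<lambda>\<epsilon> x. \<Sum>i\<in>I. f i \<epsilon> x)"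
  using assms
  by (induction I rule: infinite_finite_induct) (auto intro: derivs_O_add derivs_O_zero)

lemma derivs_O_mult:
  assumes "derivs_O k p f" "derivs_O k q g"
  shows "derivs_O k (p + q) (\<lambda>\<epsilon> x. f \<epsilon> x * g \<epsilon> x)"
  using assms
proof (induction k arbitrary: f g)
  case (Suc k)
  have "derivs_O k (p + q) (\<lambda>\<epsilon>. partial b (\<lambda>x. f \<epsilon> x * g \<epsilon> x))" if "b \<in> Basis" for b
  proof (rule derivs_O_cong)
    show "derivs_O k (p + q) (\<lambda>\<epsilon> x. f \<epsilon> x * partial b (g \<epsilon>) x + partial b (f \<epsilon>) x * g \<epsilon> x)"
      using Suc.prems[THEN derivs_O_SucD] Suc.prems[THEN derivs_O_partial, OF that]
      by (intro derivs_O_add Suc.IH)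
    show "(\<lambda>x. f \<epsilon> x * partial b (g \<epsilon>) x + partial b (f \<epsilon>) x * g \<epsilon> x) = partial b (\<lambda>x. f \<epsilon> x * g \<epsilon> x)"
      if "\<epsilon> \<in> {0<..1}" for \<epsilon>
      using Suc.prems that by (auto simp: partial_mult smooth_differentiable)
  qed
  then show ?case using Suc.prems by (auto intro: locally_O_mult smooth_mult)
qed (auto intro: locally_O_mult smooth_mult)

text \<open>Factors with locally bounded derivatives cost no power of \<epsilon>.\<close>

lemma derivs_O_bounded_mult:
  assumes "derivs_O k 0 f" "derivs_O k q g"
  shows "derivs_O k q (\<lambda>\<epsilon> x. f \<epsilon> x * g \<epsilon> x)"
  using derivs_O_mult[OF assms] by simp

lemma derivs_O_minus: "derivs_O k q g \<Longrightarrow> derivs_O k q (\<lambda>\<epsilon> x. - g \<epsilon> x)"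
  using derivs_O_bounded_mult[OF derivs_O_fixed[OF smooth_const[of "-1"]]] by force

lemma derivs_O_diff:
  assumes "derivs_O k q f" "derivs_O k q g"
  shows "derivs_O k q (\<lambda>\<epsilon> x. f \<epsilon> x - g \<epsilon> x)"
  using derivs_O_add[OF assms(1) derivs_O_minus[OF assms(2)]] by simp

text \<open>Only the reciprocal itself has to be bounded beforehand: its derivatives are polynomials
  in the reciprocal and in derivatives of \<open>g\<close>.\<close>

lemma derivs_O_inverse:
  assumes "derivs_O k 0 g" "\<And>\<epsilon> x. \<epsilon> \<in> {0<..1} \<Longrightarrow> g \<epsilon> x \<noteq> 0" "locally_O 0 (\<lambda>\<epsilon> x. inverse (g \<epsilon> x))"
  shows "derivs_O k 0 (\<lambda>\<epsilon> x. inverse (g \<epsilon> x))"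
  using assms(1)
proof (induction k)
  case 0
  then show ?case using assms by (auto intro: smooth_inverse)
next
  case (Suc k)
  have "derivs_O k 0 (\<lambda>\<epsilon>. partial b (\<lambda>x. inverse (g \<epsilon> x)))" if "b \<in> Basis" for b
  proof (rule derivs_O_cong)
    show "derivs_O k 0 (\<lambda>\<epsilon> x. - (partial b (g \<epsilon>) x * (inverse (g \<epsilon> x) * inverse (g \<epsilon> x))))"
      using Suc.IH[OF derivs_O_SucD[OF Suc.prems]] derivs_O_partial[OF Suc.prems that]
      by (intro derivs_O_minus derivs_O_bounded_mult)
    show "(\<lambda>x. - (partial b (g \<epsilon>) x * (inverse (g \<epsilon> x) * inverse (g \<epsilon> x)))) = partial b (\<lambda>x. inverse (g \<epsilon> x))"
      if "\<epsilon> \<in> {0<..1}" for \<epsilon>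
      using Suc.prems that by (auto simp: partial_inverse smooth_differentiable assms(2))
  qed
  then show ?case using Suc.prems assms by (auto intro: smooth_inverse)
qed

section \<open>Composition of families with locally bounded inner maps\<close>

lemma norm_le_components:
  fixes P :: "real \<Rightarrow> 'a::euclidean_space \<Rightarrow> 'b::euclidean_space"
  assumes "\<And>c. c \<in> Basis \<Longrightarrow> locally_O q (\<lambda>\<epsilon> x. P \<epsilon> x \<bullet> c)" "compact K"
  obtains C where "0 < C" "\<forall>\<^sub>F \<epsilon> in at_right 0. \<forall>x\<in>K. norm (P \<epsilon> x) \<le> C * \<epsilon> powr q"
proof -
  have "\<exists>C. 0 < C \<and> (\<forall>\<^sub>F \<epsilon> in at_right 0. \<forall>x\<in>K. \<bar>P \<epsilon> x \<bullet> c\<bar> \<le> C * \<epsilon> powr q)" if "c \<in> Basis" for c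
    by (rule locally_OD[OF assms(1)[OF that] assms(2)]) blast
  then have "\<forall>c\<in>Basis. \<exists>C. 0 < C \<and> (\<forall>\<^sub>F \<epsilon> in at_right 0. \<forall>x\<in>K. \<bar>P \<epsilon> x \<bullet> c\<bar> \<le> C * \<epsilon> powr q)"
    by blast
  from bchoice[OF this] obtain C where C: "\<forall>c\<in>Basis. 0 < C c \<and>
      (\<forall>\<^sub>F \<epsilon> in at_right 0. \<forall>x\<in>K. \<bar>P \<epsilon> x \<bullet> c\<bar> \<le> C c * \<epsilon> powr q)"
    by blast
  have "\<forall>\<^sub>F \<epsilon> in at_right 0. \<forall>c\<in>Basis. \<forall>x\<in>K. \<bar>P \<epsilon> x \<bullet> c\<bar> \<le> C c * \<epsilon> powr q"
    using C by (simp add: eventually_ball_finite)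
  then have "\<forall>\<^sub>F \<epsilon> in at_right 0. \<forall>x\<in>K. norm (P \<epsilon> x) \<le> (\<Sum>c\<in>Basis. C c) * \<epsilon> powr q"
  proof eventually_elim
    case (elim \<epsilon>)
    show ?case
    proof
      fix x assume "x \<in> K"
      have "norm (P \<epsilon> x) \<le> (\<Sum>c\<in>Basis. \<bar>P \<epsilon> x \<bullet> c\<bar>)" by (rule norm_le_l1)
      also have "\<dots> \<le> (\<Sum>c\<in>Basis. C c * \<epsilon> powr q)"
        using elim \<open>x \<in> K\<close> by (intro sum_mono) blast
      finally show "norm (P \<epsilon> x) \<le> (\<Sum>c\<in>Basis. C c) * \<epsilon> powr q" by (simp add: sum_distrib_right)
    qed
  qed
  moreover have "0 < (\<Sum>c\<in>(Basis::'b set). C c)"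
    using C by (intro sum_pos) auto
  ultimately show ?thesis using that by blast
qed

lemma derivs_O_compose:
  fixes P :: "real \<Rightarrow> 'a::euclidean_space \<Rightarrow> 'b::euclidean_space"
  assumes "derivs_O k q G" "\<And>c. c \<in> Basis \<Longrightarrow> derivs_O k 0 (\<lambda>\<epsilon> x. P \<epsilon> x \<bullet> c)"
  shows "derivs_O k q (\<lambda>\<epsilon> x. G \<epsilon> (P \<epsilon> x))"
proof -
  \<comment> \<open>For small \<epsilon> the inner maps send \<open>K\<close> into one fixed ball,
    on which the bound for \<open>H\<close> applies. \<open>H\<close> is general because the
    induction replaces \<open>G\<close> by its partials.\<close>
  have loc: "locally_O q (\<lambda>\<epsilon> x. H \<epsilon> (P \<epsilon> x))"
    if H: "locally_O q H" for H :: "real \<Rightarrow> 'b \<Rightarrow> real"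
    unfolding locally_O_def
  proof (intro allI impI)
    fix K :: "'a set"
    assume K: "compact K"
    from norm_le_components[OF derivs_O_locally[OF assms(2)] K]
    obtain R where R: "\<forall>\<^sub>F \<epsilon> in at_right 0. \<forall>x\<in>K. norm (P \<epsilon> x) \<le> R * \<epsilon> powr 0"
      by blast
    obtain C where C: "\<forall>\<^sub>F \<epsilon> in at_right 0. \<forall>y\<in>cball 0 R. \<bar>H \<epsilon> y\<bar> \<le> C * \<epsilon> powr q"
      using locally_OD[OF H compact_cball] by blast
    have "\<forall>\<^sub>F \<epsilon> in at_right 0. \<forall>x\<in>K. \<bar>H \<epsilon> (P \<epsilon> x)\<bar> \<le> C * \<epsilon> powr q"
      using R C eventually_unit_interval by eventually_elim auto
    then show "\<exists>C. \<forall>\<^sub>F \<epsilon> in at_right 0. \<forall>x\<in>K. \<bar>H \<epsilon> (P \<epsilon> x)\<bar> \<le> C * \<epsilon> powr q" by blast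
  qed
  show ?thesis using assms
  proof (induction k arbitrary: G)
    case 0
    then show ?case by (auto intro: loc smooth_compose)
  next
    case (Suc k)
    have sG: "smooth (G \<epsilon>)" and sP: "\<And>c. c \<in> Basis \<Longrightarrow> smooth (\<lambda>x. P \<epsilon> x \<bullet> c)" if "\<epsilon> \<in> {0<..1}" for \<epsilon>
      using that Suc.prems by (auto intro: derivs_O_smooth)
    have "derivs_O k q (\<lambda>\<epsilon>. partial b (\<lambda>x. G \<epsilon> (P \<epsilon> x)))" if b: "b \<in> Basis" for b
    proof (rule derivs_O_cong)
      have "derivs_O k q (\<lambda>\<epsilon> x. partial c (G \<epsilon>) (P \<epsilon> x))" if "c \<in> Basis" for c
        by (rule Suc.IH[OF derivs_O_partial[OF Suc.prems(1) that] derivs_O_SucD[OF Suc.prems(2)]])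
      then show "derivs_O k q (\<lambda>\<epsilon> x. \<Sum>c\<in>Basis. partial b (\<lambda>x. P \<epsilon> x \<bullet> c) x * partial c (G \<epsilon>) (P \<epsilon> x))"
        using Suc.prems b by (intro derivs_O_sum derivs_O_bounded_mult derivs_O_partial) auto
      show "(\<lambda>x. \<Sum>c\<in>Basis. partial b (\<lambda>x. P \<epsilon> x \<bullet> c) x * partial c (G \<epsilon>) (P \<epsilon> x))
          = partial b (\<lambda>x. G \<epsilon> (P \<epsilon> x))" if "\<epsilon> \<in> {0<..1}" for \<epsilon>
        using sG sP that by (auto simp: partial_compose smooth_differentiable mult.commute)
    qed
    moreover have "locally_O q (\<lambda>\<epsilon> x. G \<epsilon> (P \<epsilon> x))"
      using Suc.prems by (intro loc) auto
    ultimately show ?case using sG sP by (simp add: smooth_compose)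
  qed
qed

text \<open>The ball is convex and the partials are bounded on it, so the mean value inequality
  gives the constant as a sum of their bounds.\<close>

lemma smooth_Lipschitz_cball:
  fixes G :: "'a::euclidean_space \<Rightarrow> real"
  assumes G: "smooth G"
  obtains B where "0 \<le> B" "\<And>x y. x \<in> cball 0 R \<Longrightarrow> y \<in> cball 0 R \<Longrightarrow> \<bar>G x - G y\<bar> \<le> B * norm (x - y)"
proof -
  have "\<exists>M\<ge>0. \<forall>x\<in>cball 0 R. \<bar>partial c G x\<bar> \<le> M" if "c \<in> Basis" for c
  proof -
    have "compact (partial c G ` cball 0 R)"
      using that G by (intro compact_continuous_image smooth_continuous smooth_partial) auto
    then have "bounded (partial c G ` cball 0 R)" by (rule compact_imp_bounded)
    then obtain M where "\<forall>x\<in>cball 0 R. \<bar>partial c G x\<bar> \<le> M" by (auto simp: bounded_iff)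
    then show ?thesis by (intro exI[of _ "max 0 M"]) (auto simp: le_max_iff_disj)
  qed
  then obtain M where M: "\<And>c. c \<in> Basis \<Longrightarrow> 0 \<le> M c"
    "\<And>c x. c \<in> Basis \<Longrightarrow> x \<in> cball 0 R \<Longrightarrow> \<bar>partial c G x\<bar> \<le> M c"
    by metis
  define B where "B = (\<Sum>c\<in>Basis. M c)"
  have "norm (G x - G y) \<le> B * norm (x - y)" if xy: "x \<in> cball 0 R" "y \<in> cball 0 R" for x y
  proof (rule differentiable_bound[OF _ _ _ xy])
    show "(G has_derivative (\<lambda>h. \<Sum>c\<in>Basis. (h \<bullet> c) * partial c G z)) (at z within cball 0 R)" for z
      by (rule has_derivative_at_withinI[OF has_derivative_sum_partial[OF smooth_differentiable[OF G]]])
    show "onorm (\<lambda>h. \<Sum>c\<in>Basis. (h \<bullet> c) * partial c G z) \<le> B" if "z \<in> cball 0 R" for z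
    proof (rule onorm_le)
      fix h :: 'a
      have "norm (\<Sum>c\<in>Basis. (h \<bullet> c) * partial c G z) \<le> (\<Sum>c\<in>Basis. \<bar>h \<bullet> c\<bar> * \<bar>partial c G z\<bar>)"
        by (rule order_trans[OF norm_sum]) (simp add: abs_mult)
      also have "\<dots> \<le> (\<Sum>c\<in>Basis. norm h * M c)"
        using M that by (intro sum_mono mult_mono) (auto simp: Basis_le_norm)
      finally show "norm (\<Sum>c\<in>Basis. (h \<bullet> c) * partial c G z) \<le> B * norm h"
        by (simp add: B_def sum_distrib_left mult.commute)
    qed
  qed auto
  moreover have "0 \<le> B" unfolding B_def using M by (intro sum_nonneg) auto
  ultimately show ?thesis using that by auto
qed

text \<open>Carries smallness of \<open>P - Q\<close> through a fixed nonlinearity. It serves twice: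
  for the right-hand side \<open>F\<close> and for restricting a function to two nearby
  curves.\<close>

lemma derivs_O_compose_diff:
  fixes P Q :: "real \<Rightarrow> 'a::euclidean_space \<Rightarrow> 'b::euclidean_space"
  assumes "smooth G"
    "\<And>c. c \<in> Basis \<Longrightarrow> derivs_O k 0 (\<lambda>\<epsilon> x. P \<epsilon> x \<bullet> c)"
    "\<And>c. c \<in> Basis \<Longrightarrow> derivs_O k 0 (\<lambda>\<epsilon> x. Q \<epsilon> x \<bullet> c)"
    "\<And>c. c \<in> Basis \<Longrightarrow> derivs_O k q (\<lambda>\<epsilon> x. P \<epsilon> x \<bullet> c - Q \<epsilon> x \<bullet> c)"
  shows "derivs_O k q (\<lambda>\<epsilon> x. G (P \<epsilon> x) - G (Q \<epsilon> x))"
proof -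
  \<comment> \<open>Both inner maps eventually take \<open>K\<close> into a common ball, where
    \<open>G\<close> is Lipschitz.\<close>
  have loc: "locally_O q (\<lambda>\<epsilon> x. G (P \<epsilon> x) - G (Q \<epsilon> x))" if G: "smooth G" for G :: "'b \<Rightarrow> real"
    unfolding locally_O_def
  proof (intro allI impI)
    fix K :: "'a set"
    assume K: "compact K"
    from norm_le_components[OF derivs_O_locally[OF assms(2)] K]
    obtain R where R: "\<forall>\<^sub>F \<epsilon> in at_right 0. \<forall>x\<in>K. norm (P \<epsilon> x) \<le> R * \<epsilon> powr 0"
      by blast
    from norm_le_components[OF derivs_O_locally[OF assms(3)] K]
    obtain S where S: "\<forall>\<^sub>F \<epsilon> in at_right 0. \<forall>x\<in>K. norm (Q \<epsilon> x) \<le> S * \<epsilon> powr 0"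
      by blast
    have "\<And>c. c \<in> Basis \<Longrightarrow> locally_O q (\<lambda>\<epsilon> x. (P \<epsilon> x - Q \<epsilon> x) \<bullet> c)"
      using derivs_O_locally[OF assms(4)] by (simp add: inner_diff_left)
    from norm_le_components[OF this K]
    obtain C where C: "\<forall>\<^sub>F \<epsilon> in at_right 0. \<forall>x\<in>K. norm (P \<epsilon> x - Q \<epsilon> x) \<le> C * \<epsilon> powr q"
      by blast
    obtain B where B: "0 \<le> B"
      "\<And>x y. x \<in> cball 0 (max R S) \<Longrightarrow> y \<in> cball 0 (max R S) \<Longrightarrow> \<bar>G x - G y\<bar> \<le> B * norm (x - y)"
      using smooth_Lipschitz_cball[OF G] by metis
    have "\<forall>\<^sub>F \<epsilon> in at_right 0. \<forall>x\<in>K. \<bar>G (P \<epsilon> x) - G (Q \<epsilon> x)\<bar> \<le> (B * C) * \<epsilon> powr q"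
      using R S C eventually_unit_interval
    proof eventually_elim
      case (elim \<epsilon>)
      show ?case
      proof
        fix x assume x: "x \<in> K"
        have "norm (P \<epsilon> x) \<le> R" "norm (Q \<epsilon> x) \<le> S" using elim x by auto
        then have "\<bar>G (P \<epsilon> x) - G (Q \<epsilon> x)\<bar> \<le> B * norm (P \<epsilon> x - Q \<epsilon> x)"
          by (intro B(2)) auto
        also have "\<dots> \<le> B * (C * \<epsilon> powr q)" using B(1) elim x by (intro mult_left_mono) auto
        finally show "\<bar>G (P \<epsilon> x) - G (Q \<epsilon> x)\<bar> \<le> (B * C) * \<epsilon> powr q" by (simp add: mult.assoc)
      qed
    qed
    then show "\<exists>C. \<forall>\<^sub>F \<epsilon> in at_right 0. \<forall>x\<in>K. \<bar>G (P \<epsilon> x) - G (Q \<epsilon> x)\<bar> \<le> C * \<epsilon> powr q" by blast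
  qed
  show ?thesis using assms
  proof (induction k arbitrary: G)
    case 0
    then show ?case by (auto intro!: loc smooth_diff smooth_compose[of G])
  next
    case (Suc k)
    note SucD = Suc.prems(2-4)[THEN derivs_O_SucD]
    have sP: "smooth (\<lambda>x. P \<epsilon> x \<bullet> c)" and sQ: "smooth (\<lambda>x. Q \<epsilon> x \<bullet> c)"
      if "\<epsilon> \<in> {0<..1}" "c \<in> Basis" for \<epsilon> c
      using that derivs_O_smooth[OF Suc.prems(2)] derivs_O_smooth[OF Suc.prems(3)] by auto
    have sGP: "smooth (\<lambda>x. G (P \<epsilon> x))" and sGQ: "smooth (\<lambda>x. G (Q \<epsilon> x))" if "\<epsilon> \<in> {0<..1}" for \<epsilon>
      using sP sQ that Suc.prems(1) smooth_compose by metis+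
    have "derivs_O k q (\<lambda>\<epsilon>. partial b (\<lambda>x. G (P \<epsilon> x) - G (Q \<epsilon> x)))" if b: "b \<in> Basis" for b
    proof (rule derivs_O_cong)
      \<comment> \<open>The difference of the two chain rule sums is telescoped so that each product
        has one bounded factor and one factor of order \<open>q\<close>. The first difference is the
        induction hypothesis for a partial of \<open>G\<close>, the second the hypothesis on
        \<open>P - Q\<close>.\<close>
      show "derivs_O k q (\<lambda>\<epsilon> x. \<Sum>c\<in>Basis.
          partial b (\<lambda>x. P \<epsilon> x \<bullet> c) x * (partial c G (P \<epsilon> x) - partial c G (Q \<epsilon> x))
          + partial c G (Q \<epsilon> x) * partial b (\<lambda>x. P \<epsilon> x \<bullet> c - Q \<epsilon> x \<bullet> c) x)"
      proof (intro derivs_O_sum derivs_O_add derivs_O_bounded_mult)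
        fix c :: 'b assume c: "c \<in> Basis"
        show "derivs_O k q (\<lambda>\<epsilon> x. partial c G (P \<epsilon> x) - partial c G (Q \<epsilon> x))"
          by (rule Suc.IH[OF smooth_partial[OF Suc.prems(1) c]]) (use SucD in auto)
        show "derivs_O k 0 (\<lambda>\<epsilon> x. partial c G (Q \<epsilon> x))"
          by (rule derivs_O_compose[of k 0 "\<lambda>_. partial c G" Q])
            (use c Suc.prems(1) SucD in \<open>auto intro: derivs_O_fixed smooth_partial\<close>)
      qed (use Suc.prems b in \<open>auto intro: derivs_O_partial\<close>)
      fix \<epsilon> :: real assume e: "\<epsilon> \<in> {0<..1}"
      show "(\<lambda>x. \<Sum>c\<in>Basis.
          partial b (\<lambda>x. P \<epsilon> x \<bullet> c) x * (partial c G (P \<epsilon> x) - partial c G (Q \<epsilon> x))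
          + partial c G (Q \<epsilon> x) * partial b (\<lambda>x. P \<epsilon> x \<bullet> c - Q \<epsilon> x \<bullet> c) x)
          = partial b (\<lambda>x. G (P \<epsilon> x) - G (Q \<epsilon> x))"
      proof
        fix x
        have "partial b (\<lambda>x. G (P \<epsilon> x) - G (Q \<epsilon> x)) x
            = (\<Sum>c\<in>Basis. partial c G (P \<epsilon> x) * partial b (\<lambda>x. P \<epsilon> x \<bullet> c) x)
            - (\<Sum>c\<in>Basis. partial c G (Q \<epsilon> x) * partial b (\<lambda>x. Q \<epsilon> x \<bullet> c) x)"
          using e sP sQ sGP sGQ Suc.prems(1)
          by (simp add: partial_diff_smooth partial_compose smooth_differentiable)
        also have "\<dots> = (\<Sum>c\<in>Basis. partial c G (P \<epsilon> x) * partial b (\<lambda>x. P \<epsilon> x \<bullet> c) x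
            - partial c G (Q \<epsilon> x) * partial b (\<lambda>x. Q \<epsilon> x \<bullet> c) x)"
          by (simp add: sum_subtractf)
        also have "\<dots> = (\<Sum>c\<in>Basis.
          partial b (\<lambda>x. P \<epsilon> x \<bullet> c) x * (partial c G (P \<epsilon> x) - partial c G (Q \<epsilon> x))
          + partial c G (Q \<epsilon> x) * partial b (\<lambda>x. P \<epsilon> x \<bullet> c - Q \<epsilon> x \<bullet> c) x)"
        proof (rule sum.cong[OF refl])
          fix c :: 'b assume c: "c \<in> Basis"
          show "partial c G (P \<epsilon> x) * partial b (\<lambda>x. P \<epsilon> x \<bullet> c) x
              - partial c G (Q \<epsilon> x) * partial b (\<lambda>x. Q \<epsilon> x \<bullet> c) x
            = partial b (\<lambda>x. P \<epsilon> x \<bullet> c) x * (partial c G (P \<epsilon> x) - partial c G (Q \<epsilon> x))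
              + partial c G (Q \<epsilon> x) * partial b (\<lambda>x. P \<epsilon> x \<bullet> c - Q \<epsilon> x \<bullet> c) x"
            unfolding partial_diff_smooth[OF sP[OF e c] sQ[OF e c]] by algebra
        qed
        finally show "(\<Sum>c\<in>Basis.
          partial b (\<lambda>x. P \<epsilon> x \<bullet> c) x * (partial c G (P \<epsilon> x) - partial c G (Q \<epsilon> x))
          + partial c G (Q \<epsilon> x) * partial b (\<lambda>x. P \<epsilon> x \<bullet> c - Q \<epsilon> x \<bullet> c) x)
          = partial b (\<lambda>x. G (P \<epsilon> x) - G (Q \<epsilon> x)) x" by simp
      qed
    qed
    moreover have "locally_O q (\<lambda>\<epsilon> x. G (P \<epsilon> x) - G (Q \<epsilon> x))"
      using Suc.prems by (intro loc) auto
    ultimately show ?case using sGP sGQ by (simp add: smooth_diff)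
  qed
qed

section \<open>Seminorms and Colombeau classes\<close>

lemma set_coords: "set (coords :: 'a::euclidean_space list) = Basis"
  and distinct_coords: "distinct (coords :: 'a::euclidean_space list)"
proof -
  have "\<exists>bs::'a list. distinct bs \<and> set bs = Basis"
    using finite_distinct_list[OF finite_Basis] by blast
  from someI_ex[OF this]
  show "set (coords :: 'a list) = Basis" "distinct (coords :: 'a list)"
    unfolding coords_def by auto
qed

text \<open>Turns multi-index derivatives into iterated partials along a list of directions, the
  form that the recursion in \<open>derivs_O\<close> unfolds to; the length of the list is the
  order.\<close>

lemma multi_partial_as_word:
  fixes \<alpha> :: "'a::euclidean_space \<Rightarrow> nat"
  obtains bs where "set bs \<subseteq> Basis" "length bs = (\<Sum>b\<in>Basis. \<alpha> b)"
    "multi_partial \<alpha> = foldr partial bs"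
proof -
  define bs where "bs = concat (map (\<lambda>b. replicate (\<alpha> b) b) (coords :: 'a list))"
  have rep: "foldr partial (replicate n b) = partial b ^^ n" for n and b :: 'a
    by (induction n) auto
  have "foldr (\<lambda>b. partial b ^^ \<alpha> b) cs = foldr partial (concat (map (\<lambda>b. replicate (\<alpha> b) b) cs))"
    for cs :: "'a list"
    by (induction cs) (simp_all add: rep comp_def)
  then have "multi_partial \<alpha> = foldr partial bs"
    unfolding multi_partial_def bs_def by auto
  moreover have "length bs = (\<Sum>b\<in>Basis. \<alpha> b)"
    using sum_list_distinct_conv_sum_set[OF distinct_coords, of \<alpha>]
    by (simp add: bs_def length_concat comp_def set_coords)
  moreover have "set bs \<subseteq> Basis"
    by (auto simp: bs_def set_coords)
  ultimately show ?thesis using that by blast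
qed

lemma smooth_foldr_partial: "smooth g \<Longrightarrow> set bs \<subseteq> Basis \<Longrightarrow> smooth (foldr partial bs g)"
  by (induction bs) (auto intro: smooth_partial)

lemma foldr_partial_diff:
  assumes "smooth f" "smooth g" "set bs \<subseteq> Basis"
  shows "foldr partial bs (\<lambda>x. f x - g x) = (\<lambda>x. foldr partial bs f x - foldr partial bs g x)"
  using assms(3)
proof (induction bs)
  case (Cons b bs)
  then show ?case
    using smooth_foldr_partial[OF assms(1)] smooth_foldr_partial[OF assms(2)]
    by (auto simp: partial_diff_smooth)
qed auto

lemma derivs_O_foldr_partial:
  assumes "derivs_O (k + length bs) q g" "set bs \<subseteq> Basis"
  shows "derivs_O k q (\<lambda>\<epsilon>. foldr partial bs (g \<epsilon>))"
  using assms
proof (induction bs arbitrary: k)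
  case (Cons b bs)
  from Cons.prems Cons.IH[of "Suc k"] derivs_O_partial[of k q _ b] show ?case by auto
qed auto

lemma finite_words: "finite {bs. set bs \<subseteq> (Basis :: 'a::euclidean_space set) \<and> length bs \<le> l}"
  by (rule finite_lists_length_le) simp

lemma seminorm_le:
  assumes "0 \<le> C"
    "\<And>bs x. set bs \<subseteq> Basis \<Longrightarrow> length bs \<le> l \<Longrightarrow> x \<in> K \<Longrightarrow> \<bar>foldr partial bs g x\<bar> \<le> C"
  shows "seminorm K l g \<le> C"
proof -
  have "\<bar>multi_partial \<alpha> g x\<bar> \<le> C" if "(\<Sum>b\<in>Basis. \<alpha> b) \<le> l" "x \<in> K" for \<alpha> x
    using that assms(2) multi_partial_as_word[of \<alpha>] by metis
  then show ?thesis
    unfolding seminorm_def using assms(1) by (intro cSup_least) auto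
qed

text \<open>A real \<open>Sup\<close> is meaningful only for sets bounded above. All multi-indices
  of order at most \<open>l\<close> reduce to finitely many words, each giving a continuous function
  on \<open>K\<close>.\<close>

lemma bdd_above_derivatives:
  assumes g: "smooth g" and K: "compact K"
  shows "bdd_above (insert 0 {\<bar>multi_partial \<alpha> g x\<bar> | \<alpha> x. (\<Sum>b\<in>Basis. \<alpha> b) \<le> l \<and> x \<in> K})"
proof -
  have "\<exists>M\<ge>0. \<forall>x\<in>K. \<bar>foldr partial bs g x\<bar> \<le> M" if "set bs \<subseteq> Basis" for bs
  proof -
    have "compact (foldr partial bs g ` K)"
      using that g K by (intro compact_continuous_image smooth_continuous smooth_foldr_partial)
    then obtain M where "\<forall>x\<in>K. \<bar>foldr partial bs g x\<bar> \<le> M"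
      by (auto dest!: compact_imp_bounded simp: bounded_iff)
    then show ?thesis by (intro exI[of _ "max 0 M"]) (auto simp: le_max_iff_disj)
  qed
  then have "\<forall>bs\<in>{bs. set bs \<subseteq> Basis \<and> length bs \<le> l}. \<exists>M\<ge>0. \<forall>x\<in>K. \<bar>foldr partial bs g x\<bar> \<le> M"
    by blast
  from bchoice[OF this] obtain M where
    M: "\<forall>bs\<in>{bs. set bs \<subseteq> Basis \<and> length bs \<le> l}. 0 \<le> M bs \<and> (\<forall>x\<in>K. \<bar>foldr partial bs g x\<bar> \<le> M bs)"
    by blast
  define B where "B = (\<Sum>bs | set bs \<subseteq> Basis \<and> length bs \<le> l. M bs)"
  have "\<bar>multi_partial \<alpha> g x\<bar> \<le> B" if \<alpha>: "(\<Sum>b\<in>Basis. \<alpha> b) \<le> l" "x \<in> K" for \<alpha> x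
  proof -
    obtain bs where bs: "set bs \<subseteq> Basis" "length bs \<le> l" "multi_partial \<alpha> = foldr partial bs"
      using multi_partial_as_word[of \<alpha>] \<alpha>(1) by metis
    have "M bs \<le> B" unfolding B_def
      by (rule member_le_sum) (use M bs finite_words in auto)
    moreover have "\<bar>foldr partial bs g x\<bar> \<le> M bs" using M bs \<alpha>(2) by blast
    ultimately show ?thesis using bs(3) by simp
  qed
  moreover have "0 \<le> B" unfolding B_def using M by (intro sum_nonneg) auto
  ultimately show ?thesis unfolding bdd_above_def by blast
qed

lemma multi_partial_le_seminorm:
  assumes "smooth g" "compact K" "(\<Sum>b\<in>Basis. \<alpha> b) \<le> l" "x \<in> K"
  shows "\<bar>multi_partial \<alpha> g x\<bar> \<le> seminorm K l g"
  unfolding seminorm_def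
  by (rule cSup_upper[OF _ bdd_above_derivatives[OF assms(1,2)]]) (use assms in auto)

lemma seminorm_nonneg:
  assumes "smooth g" "compact K"
  shows "0 \<le> seminorm K l g"
  unfolding seminorm_def
  by (rule cSup_upper[OF _ bdd_above_derivatives[OF assms]]) auto

lemma seminorm_diff_le:
  assumes "smooth f" "smooth g" "compact K"
  shows "seminorm K l (\<lambda>x. f x - g x) \<le> seminorm K l f + seminorm K l g"
proof -
  have "\<bar>multi_partial \<alpha> (\<lambda>x. f x - g x) x\<bar> \<le> seminorm K l f + seminorm K l g"
    if "(\<Sum>b\<in>Basis. \<alpha> b) \<le> l" "x \<in> K" for \<alpha> x
  proof -
    obtain bs where bs: "set bs \<subseteq> Basis" "multi_partial \<alpha> = foldr partial bs"
      using multi_partial_as_word[of \<alpha>] by metis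
    then have "multi_partial \<alpha> (\<lambda>x. f x - g x) x = multi_partial \<alpha> f x - multi_partial \<alpha> g x"
      using foldr_partial_diff[OF assms(1,2) bs(1)] by simp
    then show ?thesis
      using multi_partial_le_seminorm[OF assms(1,3) that] multi_partial_le_seminorm[OF assms(2,3) that]
      by simp
  qed
  then show ?thesis
    unfolding seminorm_def[of _ _ "\<lambda>x. f x - g x"]
    using seminorm_nonneg[OF assms(1,3), of l] seminorm_nonneg[OF assms(2,3), of l]
    by (intro cSup_least) auto
qed

text \<open>Since there are finitely many words, their constants can be added and their ranges of
  small \<epsilon> intersected.\<close>

lemma derivs_O_imp_seminorm:
  assumes g: "\<And>k. derivs_O k q g" and K: "compact K"
  shows "(\<lambda>\<epsilon>. seminorm K l (g \<epsilon>)) \<in> O[at_right 0](\<lambda>\<epsilon>. \<epsilon> powr q)"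
proof -
  have "\<exists>C. 0 < C \<and> (\<forall>\<^sub>F \<epsilon> in at_right 0. \<forall>x\<in>K. \<bar>foldr partial bs (g \<epsilon>) x\<bar> \<le> C * \<epsilon> powr q)"
    if "set bs \<subseteq> Basis" for bs
    by (rule locally_OD[OF derivs_O_locally[OF derivs_O_foldr_partial[of 0, OF g that]] K]) blast
  then have "\<forall>bs\<in>{bs. set bs \<subseteq> Basis \<and> length bs \<le> l}. \<exists>C. 0 < C \<and>
      (\<forall>\<^sub>F \<epsilon> in at_right 0. \<forall>x\<in>K. \<bar>foldr partial bs (g \<epsilon>) x\<bar> \<le> C * \<epsilon> powr q)" by blast
  from bchoice[OF this] obtain C where C: "\<forall>bs\<in>{bs. set bs \<subseteq> Basis \<and> length bs \<le> l}. 0 < C bs \<and>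
      (\<forall>\<^sub>F \<epsilon> in at_right 0. \<forall>x\<in>K. \<bar>foldr partial bs (g \<epsilon>) x\<bar> \<le> C bs * \<epsilon> powr q)"
    by blast
  define B where "B = (\<Sum>bs | set bs \<subseteq> Basis \<and> length bs \<le> l. C bs)"
  have CB: "C bs \<le> B" if "set bs \<subseteq> Basis" "length bs \<le> l" for bs
    unfolding B_def by (rule member_le_sum) (use C that finite_words in \<open>auto intro: less_imp_le\<close>)
  have B0: "0 \<le> B" unfolding B_def using C by (intro sum_nonneg) (auto intro: less_imp_le)
  have "\<forall>\<^sub>F \<epsilon> in at_right 0. \<forall>bs\<in>{bs. set bs \<subseteq> Basis \<and> length bs \<le> l}.
      \<forall>x\<in>K. \<bar>foldr partial bs (g \<epsilon>) x\<bar> \<le> C bs * \<epsilon> powr q"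
    using C by (intro eventually_ball_finite finite_words) blast
  then have "\<forall>\<^sub>F \<epsilon> in at_right 0. norm (seminorm K l (g \<epsilon>)) \<le> B * norm (\<epsilon> powr q)"
    using eventually_unit_interval
  proof eventually_elim
    case (elim \<epsilon>)
    have "seminorm K l (g \<epsilon>) \<le> B * \<epsilon> powr q"
    proof (rule seminorm_le)
      fix bs :: "'a list" and x assume bs: "set bs \<subseteq> Basis" "length bs \<le> l" "x \<in> K"
      have "\<bar>foldr partial bs (g \<epsilon>) x\<bar> \<le> C bs * \<epsilon> powr q" using elim bs by auto
      also have "\<dots> \<le> B * \<epsilon> powr q" using CB[OF bs(1,2)] by (rule mult_right_mono) simp
      finally show "\<bar>foldr partial bs (g \<epsilon>) x\<bar> \<le> B * \<epsilon> powr q" .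
    qed (use B0 in simp)
    moreover have "0 \<le> seminorm K l (g \<epsilon>)"
      using seminorm_nonneg derivs_O_smooth[OF g] elim K by blast
    ultimately show ?case by simp
  qed
  then show ?thesis by (rule bigoI)
qed

lemma derivs_O_imp_null:
  assumes "\<And>k q. 0 < q \<Longrightarrow> derivs_O k q g"
  shows "g \<in> null_families"
  unfolding null_families_def
  using derivs_O_smooth[OF assms[OF zero_less_one]] derivs_O_imp_seminorm[OF assms] by auto

text \<open>Moderateness asks for a strictly positive \<open>p\<close>, so the bounded family is
  weakened to the exponent -1.\<close>

lemma derivs_O_imp_moderate:
  assumes g: "\<And>k. derivs_O k 0 g"
  shows "g \<in> moderate"
proof -
  have "(\<lambda>\<epsilon>. seminorm K l (g \<epsilon>)) \<in> O[at_right 0](\<lambda>\<epsilon>. \<epsilon> powr (- 1))" if "compact K" for K l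
    using derivs_O_antimono[OF g, of "-1"] that by (intro derivs_O_imp_seminorm) auto
  then show ?thesis
    unfolding moderate_def using derivs_O_smooth[OF g] by (auto intro!: exI[of _ 1])
qed

text \<open>The way back from seminorms, for the curves. In one variable every word is a power of
  \<open>partial 1\<close>, so each word is itself a multi-index derivative.\<close>

lemma null_imp_derivs_O:
  fixes g :: "real \<Rightarrow> real \<Rightarrow> real"
  assumes g: "g \<in> null_families" and q: "0 < q"
  shows "derivs_O k q g"
proof -
  have sm: "smooth (g \<epsilon>)" if "\<epsilon> \<in> {0<..1}" for \<epsilon>
    using g that unfolding null_families_def by blast
  then have sm': "smooth ((partial 1 ^^ j) (g \<epsilon>))" if "\<epsilon> \<in> {0<..1}" for \<epsilon> j
    by (induction j) (use that in \<open>auto intro: smooth_partial\<close>)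
  have "length (coords :: real list) = 1"
    using distinct_card[OF distinct_coords[where 'a = real]] by (simp add: set_coords)
  \<comment> \<open>\<open>coords\<close> is a choice, but a one-element basis determines
    it.\<close>
  then obtain a :: real where a: "coords = [a]" by (auto simp: length_Suc_conv)
  have "set [a] = (Basis :: real set)"
    unfolding a[symmetric] by (rule set_coords)
  then have "a = 1" by simp
  then have mp: "multi_partial (\<lambda>_. j) h = (partial 1 ^^ j) h" for j and h :: "real \<Rightarrow> real"
    unfolding multi_partial_def a by simp
  have loc: "locally_O q (\<lambda>\<epsilon>. (partial 1 ^^ j) (g \<epsilon>))" for j
    unfolding locally_O_def
  proof (intro allI impI)
    fix K :: "real set"
    assume K: "compact K"
    then have "(\<lambda>\<epsilon>. seminorm K j (g \<epsilon>)) \<in> O[at_right 0](\<lambda>\<epsilon>. \<epsilon> powr q)"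
      using g q unfolding null_families_def by blast
    then obtain C where "\<forall>\<^sub>F \<epsilon> in at_right 0. norm (seminorm K j (g \<epsilon>)) \<le> C * norm (\<epsilon> powr q)"
      by (elim landau_o.bigE)
    then have "\<forall>\<^sub>F \<epsilon> in at_right 0. \<forall>x\<in>K. \<bar>(partial 1 ^^ j) (g \<epsilon>) x\<bar> \<le> C * \<epsilon> powr q"
      using eventually_unit_interval
    proof eventually_elim
      case (elim \<epsilon>)
      show ?case
      proof
        fix x assume "x \<in> K"
        then have "\<bar>(partial 1 ^^ j) (g \<epsilon>) x\<bar> \<le> seminorm K j (g \<epsilon>)"
          using multi_partial_le_seminorm[OF sm[OF elim(2)] K, of "\<lambda>_. j" j x] mp by simp
        then show "\<bar>(partial 1 ^^ j) (g \<epsilon>) x\<bar> \<le> C * \<epsilon> powr q" using elim(1) by simp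
      qed
    qed
    then show "\<exists>C. \<forall>\<^sub>F \<epsilon> in at_right 0. \<forall>x\<in>K. \<bar>(partial 1 ^^ j) (g \<epsilon>) x\<bar> \<le> C * \<epsilon> powr q" by blast
  qed
  \<comment> \<open>The claim is made for every \<open>j\<close>, since taking one more partial
    shifts \<open>j\<close> in the induction on \<open>k\<close>.\<close>
  have "derivs_O k q (\<lambda>\<epsilon>. (partial 1 ^^ j) (g \<epsilon>))" for j
  proof (induction k arbitrary: j)
    case (Suc k)
    from Suc.IH[of "Suc j"] show ?case using sm' loc by simp
  qed (use sm' loc in simp)
  from this[of 0] show ?thesis by simp
qed

text \<open>Closure under differences is enough to compare classes: with \<open>zero_null\<close> it
  gives symmetry of the relation, and subtracting two differences gives transitivity.\<close>

lemma null_families_diff: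
  assumes "f \<in> null_families" "g \<in> null_families"
  shows "(\<lambda>\<epsilon> x. f \<epsilon> x - g \<epsilon> x) \<in> null_families"
proof -
  have sm: "smooth (f \<epsilon>)" "smooth (g \<epsilon>)" if "\<epsilon> \<in> {0<..1}" for \<epsilon>
    using assms that unfolding null_families_def by blast+
  have "(\<lambda>\<epsilon>. seminorm K l (\<lambda>x. f \<epsilon> x - g \<epsilon> x)) \<in> O[at_right 0](\<lambda>\<epsilon>. \<epsilon> powr q)"
    if K: "compact K" and q: "0 < q" for K l q
  proof -
    have "(\<lambda>\<epsilon>. seminorm K l (f \<epsilon>) + seminorm K l (g \<epsilon>)) \<in> O[at_right 0](\<lambda>\<epsilon>. \<epsilon> powr q)"
      using assms K q unfolding null_families_def by (intro sum_in_bigo) blast+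
    moreover have "\<forall>\<^sub>F \<epsilon> in at_right 0. norm (seminorm K l (\<lambda>x. f \<epsilon> x - g \<epsilon> x))
        \<le> norm (seminorm K l (f \<epsilon>) + seminorm K l (g \<epsilon>))"
      using eventually_unit_interval
    proof eventually_elim
      case (elim \<epsilon>)
      show ?case
        using seminorm_diff_le[OF sm[OF elim] K, of l] seminorm_nonneg[OF smooth_diff[OF sm[OF elim]] K, of l]
        by simp
    qed
    then have "(\<lambda>\<epsilon>. seminorm K l (\<lambda>x. f \<epsilon> x - g \<epsilon> x))
        \<in> O[at_right 0](\<lambda>\<epsilon>. seminorm K l (f \<epsilon>) + seminorm K l (g \<epsilon>))"
      by (rule landau_o.big_mono)
    ultimately show ?thesis using landau_o.big_trans by fast
  qed
  then show ?thesis unfolding null_families_def using sm smooth_diff by blast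
qed

lemma zero_null: "(\<lambda>_ _. 0) \<in> null_families"
  using derivs_O_zero by (rule derivs_O_imp_null)

lemma gclass_eqI:
  assumes "u \<in> moderate" "v \<in> moderate" and uv: "(\<lambda>\<epsilon> x. u \<epsilon> x - v \<epsilon> x) \<in> null_families"
  shows "gclass u = gclass v"
proof -
  have vu: "(\<lambda>\<epsilon> x. v \<epsilon> x - u \<epsilon> x) \<in> null_families"
    using null_families_diff[OF zero_null uv] by simp
  have "(\<lambda>\<epsilon> x. u \<epsilon> x - w \<epsilon> x) \<in> null_families \<longleftrightarrow> (\<lambda>\<epsilon> x. v \<epsilon> x - w \<epsilon> x) \<in> null_families" for w
    using null_families_diff[OF _ uv, of "\<lambda>\<epsilon> x. u \<epsilon> x - w \<epsilon> x"]
      null_families_diff[OF _ vu, of "\<lambda>\<epsilon> x. v \<epsilon> x - w \<epsilon> x"] by auto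
  then show ?thesis
    using assms(1,2) unfolding gclass_def colombeau_rel_def by auto
qed

lemma gclass_eqD:
  assumes "gclass u = gclass v" "u \<in> moderate"
  shows "(\<lambda>\<epsilon> x. u \<epsilon> x - v \<epsilon> x) \<in> null_families"
proof -
  have "u \<in> gclass u"
    using assms(2) zero_null by (simp add: gclass_def colombeau_rel_def)
  then have "(\<lambda>\<epsilon> x. v \<epsilon> x - u \<epsilon> x) \<in> null_families"
    unfolding assms(1) by (simp add: gclass_def colombeau_rel_def)
  from null_families_diff[OF zero_null this] show ?thesis by simp
qed

section \<open>Weighted estimate for the Goursat equation\<close>

text \<open>Stands in for integration: with an explicit antiderivative of the bound as \<phi>, no
  integral has to be evaluated. The mean value bound is applied for \<open>a < b\<close>, hence the
  split.\<close>

lemma increment_le_dominating: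
  fixes f \<phi> :: "real \<Rightarrow> real"
  assumes "a \<le> b" "\<And>x. (f has_real_derivative f' x) (at x)" "\<And>x. (\<phi> has_real_derivative \<phi>' x) (at x)"
    "\<And>x. a \<le> x \<Longrightarrow> x \<le> b \<Longrightarrow> \<bar>f' x\<bar> \<le> \<phi>' x"
  shows "\<bar>f b - f a\<bar> \<le> \<phi> b - \<phi> a"
proof (cases "a = b")
  case False
  have "norm (f b - f a) \<le> \<phi> b - \<phi> a"
  proof (rule differentiable_bound_general)
    show "a < b" using assms(1) False by simp
    show "continuous_on {a..b} f" "continuous_on {a..b} \<phi>"
      using assms(2,3) by (meson DERIV_continuous_on has_field_derivative_at_within)+
    show "(f has_vector_derivative f' x) (at x)" "(\<phi> has_vector_derivative \<phi>' x) (at x)" for x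
      using assms(2,3) by (simp_all add: has_real_derivative_iff_has_vector_derivative)
    show "norm (f' x) \<le> \<phi>' x" if "a < x" "x < b" for x
      using assms(4) that by simp
  qed
  then show ?thesis by simp
qed simp

text \<open>Above the curve the domain of dependence of \<open>(x, y)\<close> is the triangle \<open>x \<le> s\<close>, \<open>t \<le> y\<close>,
  \<open>h s \<le> t\<close>. With the weight \<open>exp (\<mu> (y - x))\<close> the two integrations gain a factor \<open>1 / \<mu>\<^sup>2\<close>, which
  beats the Lipschitz constant \<open>\<mu>\<^sup>2 / 2\<close>.\<close>

lemma goursat_above_curve:
  fixes d e H :: "real \<Rightarrow> real \<Rightarrow> real" and h :: "real \<Rightarrow> real"
  assumes d: "\<And>x y. ((\<lambda>y. d x y) has_real_derivative e x y) (at y)"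
    and e: "\<And>x y. ((\<lambda>x. e x y) has_real_derivative H x y) (at x)"
    and h: "mono h" "\<And>y. \<exists>s. h s = y"
    and box: "\<And>x y. (x, y) \<in> T \<Longrightarrow> \<bar>x\<bar> \<le> R \<and> \<bar>y\<bar> \<le> R"
    and T: "T = {(x, y). A \<le> x \<and> x \<le> B \<and> h x \<le> y \<and> y \<le> h B}"
    and H: "\<And>x y. (x, y) \<in> T \<Longrightarrow> \<bar>H x y\<bar> \<le> \<mu>\<^sup>2 / 2 * \<bar>d x y\<bar>"
    and \<mu>: "0 < \<mu>"
    and bdd: "\<And>x y. (x, y) \<in> T \<Longrightarrow> \<bar>d x y\<bar> \<le> N"
    and data: "\<And>x. A \<le> x \<Longrightarrow> x \<le> B \<Longrightarrow> \<bar>d x (h x)\<bar> \<le> \<delta>" "\<And>x. A \<le> x \<Longrightarrow> x \<le> B \<Longrightarrow> \<bar>e x (h x)\<bar> \<le> \<delta>"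
    and xy: "(x, y) \<in> T"
  shows "\<bar>d x y\<bar> \<le> 2 * (1 + 2 * R) * exp (4 * \<mu> * R) * \<delta>"
proof -
  \<comment> \<open>The weighted supremum norm of \<open>d\<close> on the region. The qualitative
    bound \<open>N\<close> makes it finite, which the final absorption relies on.\<close>
  define M where "M = (SUP (x, y)\<in>T. \<bar>d x y\<bar> * exp (- \<mu> * (y - x)))"
  have R: "0 \<le> R" using box[OF xy] by linarith
  have \<delta>: "0 \<le> \<delta>" using data(1)[of x] xy T by fastforce
  have yx: "\<bar>y - x\<bar> \<le> 2 * R" if "(x, y) \<in> T" for x y using box[OF that] by linarith
  have expb: "exp (\<mu> * (y - x)) \<le> exp (2 * \<mu> * R)" "exp (- \<mu> * (y - x)) \<le> exp (2 * \<mu> * R)"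
    if "(x, y) \<in> T" for x y
  proof -
    have "\<mu> * (y - x) \<le> \<mu> * (2 * R)" "\<mu> * (- (y - x)) \<le> \<mu> * (2 * R)"
      using yx[OF that] \<mu> by (intro mult_left_mono; linarith)+
    then show "exp (\<mu> * (y - x)) \<le> exp (2 * \<mu> * R)" "exp (- \<mu> * (y - x)) \<le> exp (2 * \<mu> * R)"
      by (simp_all add: algebra_simps)
  qed
  have "bdd_above ((\<lambda>(x, y). \<bar>d x y\<bar> * exp (- \<mu> * (y - x))) ` T)"
  proof (rule bdd_aboveI2)
    fix p assume p: "p \<in> T"
    obtain x y where [simp]: "p = (x, y)" by (cases p)
    have "\<bar>d x y\<bar> * exp (- \<mu> * (y - x)) \<le> N * exp (2 * \<mu> * R)"
      using p bdd[of x y] expb(2)[of x y] by (intro mult_mono) (auto intro: order_trans[OF abs_ge_zero])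
    then show "(case p of (x, y) \<Rightarrow> \<bar>d x y\<bar> * exp (- \<mu> * (y - x))) \<le> N * exp (2 * \<mu> * R)" by simp
  qed
  then have "\<bar>d x y\<bar> * exp (- \<mu> * (y - x)) \<le> M" if "(x, y) \<in> T" for x y
    unfolding M_def using that by (intro cSUP_upper2[of _ _ "(x, y)"]) auto
  moreover have "exp (- \<mu> * (y - x)) * exp (\<mu> * (y - x)) = 1" for x y
    by (simp add: exp_add[symmetric])
  ultimately have dM: "\<bar>d x y\<bar> \<le> M * exp (\<mu> * (y - x))" if "(x, y) \<in> T" for x y
    using mult_right_mono[of "\<bar>d x y\<bar> * exp (- \<mu> * (y - x))" M "exp (\<mu> * (y - x))"] that
    by (simp add: mult.assoc)
  have M: "0 \<le> M" using dM[OF xy] by (smt (verit) exp_gt_zero mult_neg_pos)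
  have eM: "\<bar>e x y\<bar> \<le> \<delta> + \<mu> / 2 * M * exp (\<mu> * (y - x))" if xy: "(x, y) \<in> T" for x y
  proof -
    obtain s where s: "h s = y" using h(2) by blast
    \<comment> \<open>\<open>h\<close> is only monotone, so the chosen preimage may miss the
      interval from \<open>x\<close> to \<open>B\<close>. In that case \<open>h\<close> already
      takes the value \<open>y\<close> at the nearer endpoint, and clamping is harmless.\<close>
    define s' where "s' = (if s < x then x else if B < s then B else s)"
    have s': "x \<le> s'" "s' \<le> B" "h s' = y"
      using s xy T monoD[OF h(1), of s x] monoD[OF h(1), of B s] by (auto simp: s'_def)
    have inT: "(\<xi>, y) \<in> T" if "x \<le> \<xi>" "\<xi> \<le> s'" for \<xi>
      using that s' xy T monoD[OF h(1), of \<xi> s'] by auto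
    \<comment> \<open>Horizontal integration from \<open>(x, y)\<close> to the curve. The dominating
      function is an antiderivative of the weighted bound on \<open>H\<close> and gains a factor
      1/\<mu>; its contribution at \<open>s'\<close> has a favourable sign and is dropped.\<close>
    have "\<bar>e s' y - e x y\<bar> \<le> - (\<mu> / 2 * M * exp (\<mu> * (y - s'))) - - (\<mu> / 2 * M * exp (\<mu> * (y - x)))"
    proof (rule increment_le_dominating[OF s'(1) e])
      show "((\<lambda>\<xi>. - (\<mu> / 2 * M * exp (\<mu> * (y - \<xi>)))) has_real_derivative
          \<mu>\<^sup>2 / 2 * (M * exp (\<mu> * (y - \<xi>)))) (at \<xi>)" for \<xi>
        by (auto intro!: derivative_eq_intros simp: power2_eq_square)
      show "\<bar>H \<xi> y\<bar> \<le> \<mu>\<^sup>2 / 2 * (M * exp (\<mu> * (y - \<xi>)))" if "x \<le> \<xi>" "\<xi> \<le> s'" for \<xi>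
        using H[OF inT[OF that]] mult_left_mono[OF dM[OF inT[OF that]], of "\<mu>\<^sup>2 / 2"] by simp
    qed
    moreover have "0 \<le> \<mu> / 2 * M * exp (\<mu> * (y - s'))" using \<mu> M by simp
    moreover have "\<bar>e s' y\<bar> \<le> \<delta>" using data(2)[of s'] s' xy T by auto
    ultimately show ?thesis by linarith
  qed
  have "\<bar>d x y\<bar> * exp (- \<mu> * (y - x)) \<le> \<delta> * (1 + 2 * R) * exp (2 * \<mu> * R) + M / 2" if xy: "(x, y) \<in> T" for x y
  proof -
    have inT: "(x, \<eta>) \<in> T" if "h x \<le> \<eta>" "\<eta> \<le> y" for \<eta> using that xy T by auto
    have hx: "h x \<le> y" "A \<le> x" "x \<le> B" using xy T by auto
    \<comment> \<open>Vertical integration from the curve gains the second factor 1/\<mu> and leaves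
      the coefficient \<open>M / 2\<close>.\<close>
    have "\<bar>d x y - d x (h x)\<bar> \<le> (\<delta> * y + M / 2 * exp (\<mu> * (y - x))) - (\<delta> * h x + M / 2 * exp (\<mu> * (h x - x)))"
    proof (rule increment_le_dominating[OF hx(1) d])
      show "((\<lambda>\<eta>. \<delta> * \<eta> + M / 2 * exp (\<mu> * (\<eta> - x))) has_real_derivative
          \<delta> + \<mu> / 2 * M * exp (\<mu> * (\<eta> - x))) (at \<eta>)" for \<eta>
        by (auto intro!: derivative_eq_intros)
    qed (use eM inT in auto)
    moreover have "0 \<le> M / 2 * exp (\<mu> * (h x - x))" using M by simp
    moreover have "\<bar>d x (h x)\<bar> \<le> \<delta>" using data(1) hx by simp
    moreover have "\<delta> * (y - h x) \<le> \<delta> * (2 * R)"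
      using \<delta> box[OF xy] box[OF inT[OF order_refl hx(1)]] by (intro mult_left_mono) linarith+
    ultimately have "\<bar>d x y\<bar> \<le> \<delta> * (1 + 2 * R) + M / 2 * exp (\<mu> * (y - x))"
      by (simp add: algebra_simps)
    from mult_right_mono[OF this, of "exp (- \<mu> * (y - x))"]
    have "\<bar>d x y\<bar> * exp (- \<mu> * (y - x)) \<le> \<delta> * (1 + 2 * R) * exp (- \<mu> * (y - x)) + M / 2"
      by (simp add: distrib_right mult.assoc exp_add[symmetric])
    also have "\<dots> \<le> \<delta> * (1 + 2 * R) * exp (2 * \<mu> * R) + M / 2"
      using \<delta> R expb(2)[OF xy] by (intro add_right_mono mult_left_mono) auto
    finally show ?thesis .
  qed
  \<comment> \<open>Taking the supremum gives \<open>M\<close> at most a data term plus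
    \<open>M / 2\<close>, and the half is absorbed because \<open>M\<close> is a finite
    supremum.\<close>
  then have "M \<le> \<delta> * (1 + 2 * R) * exp (2 * \<mu> * R) + M / 2"
    unfolding M_def using xy by (intro cSUP_least) auto
  then have "M \<le> 2 * (\<delta> * (1 + 2 * R) * exp (2 * \<mu> * R))" by simp
  \<comment> \<open>Removing the weight costs a second exponential, which explains the 4 in the
    final exponent.\<close>
  then have "M * exp (\<mu> * (y - x)) \<le> 2 * (\<delta> * (1 + 2 * R) * exp (2 * \<mu> * R)) * exp (2 * \<mu> * R)"
    using expb(1)[OF xy] \<delta> R by (intro mult_mono) auto
  also have "\<dots> = 2 * (1 + 2 * R) * exp (4 * \<mu> * R) * \<delta>"
  proof -
    have "exp (4 * \<mu> * R) = exp (2 * \<mu> * R) * exp (2 * \<mu> * R)"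
      by (simp add: exp_add[symmetric])
    then show ?thesis by algebra
  qed
  finally show ?thesis using dM[OF xy] by linarith
qed

section \<open>Functions on the plane and the estimate on both sides of the curve\<close>

lemma Basis_real_prod: "(Basis :: (real \<times> real) set) = {(1, 0), (0, 1)}"
  by (auto simp: Basis_prod_def)

lemma has_derivative_fst_var:
  fixes g :: "real \<times> real \<Rightarrow> real"
  assumes "smooth g"
  shows "((\<lambda>x. g (x, y)) has_real_derivative partial (1, 0) g (x, y)) (at x)"
  using has_real_derivative_partial[of g "(0, y)" x "(1, 0)"] smooth_differentiable[OF assms] by simp

lemma has_derivative_snd_var:
  fixes g :: "real \<times> real \<Rightarrow> real"
  assumes "smooth g"
  shows "((\<lambda>y. g (x, y)) has_real_derivative partial (0, 1) g (x, y)) (at y)"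
  using has_real_derivative_partial[of g "(x, 0)" y "(0, 1)"] smooth_differentiable[OF assms] by simp

text \<open>The curve cuts the rectangle into two regions of dependence, one above and one below.
  The constant involves only \<open>R\<close> and \<mu>, not \<open>h\<close> or \<open>d\<close>,
  so the estimate is uniform along a family of curves.\<close>

theorem goursat_estimate:
  fixes d :: "real \<times> real \<Rightarrow> real" and h :: "real \<Rightarrow> real"
  assumes d: "smooth d" and h: "strict_mono h" "range h = UNIV"
    and box: "-R \<le> A" "B \<le> R" "-R \<le> h A" "h B \<le> R"
    and H: "\<And>x y. \<bar>x\<bar> \<le> R \<Longrightarrow> \<bar>y\<bar> \<le> R \<Longrightarrow>
      \<bar>partial (1, 0) (partial (0, 1) d) (x, y)\<bar> \<le> \<mu>\<^sup>2 / 2 * \<bar>d (x, y)\<bar>"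
    and \<mu>: "0 < \<mu>"
    and data: "\<And>x. A \<le> x \<Longrightarrow> x \<le> B \<Longrightarrow> \<bar>d (x, h x)\<bar> \<le> \<delta>"
      "\<And>x. A \<le> x \<Longrightarrow> x \<le> B \<Longrightarrow> \<bar>partial (0, 1) d (x, h x)\<bar> \<le> \<delta>"
    and xy: "A \<le> x" "x \<le> B" "h A \<le> y" "y \<le> h B"
  shows "\<bar>d (x, y)\<bar> \<le> 2 * (1 + 2 * R) * exp (4 * \<mu> * R) * \<delta>"
proof -
  have mono: "mono h" using h(1) by (rule strict_mono_mono)
  have hAB: "h A \<le> h x" "h x \<le> h B" if "A \<le> x" "x \<le> B" for x
    using that monoD[OF mono] by blast+
  \<comment> \<open>The resulting \<open>N\<close> may depend on \<open>d\<close>: it only secures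
    finiteness of the weighted supremum.\<close>
  have "compact (d ` ({-R..R} \<times> {-R..R}))"
    by (intro compact_continuous_image smooth_continuous d compact_Times compact_Icc)
  from compact_imp_bounded[OF this]
  obtain N where "\<forall>p\<in>{-R..R} \<times> {-R..R}. \<bar>d p\<bar> \<le> N"
    by (auto simp: bounded_iff)
  then have N: "\<bar>d (x, y)\<bar> \<le> N" if "\<bar>x\<bar> \<le> R" "\<bar>y\<bar> \<le> R" for x y
    using that by (auto simp: abs_le_iff)
  note dx = has_derivative_fst_var[OF smooth_partial[OF d]]
  note dy = has_derivative_snd_var[OF d]
  show ?thesis
  proof (cases "h x \<le> y")
    case True
    show ?thesis
    proof (rule goursat_above_curve[where d = "\<lambda>x y. d (x, y)" and e = "\<lambda>x y. partial (0, 1) d (x, y)"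
          and h = h and A = A and B = B and R = R, OF dy _ mono])
      show "((\<lambda>x. partial (0, 1) d (x, y)) has_real_derivative partial (1, 0) (partial (0, 1) d) (x, y)) (at x)"
        for x y by (rule dx) (simp add: Basis_real_prod)
      show "\<exists>s. h s = y" for y using h(2) by (metis surj_def)
      show "(x, y) \<in> {(x, y). A \<le> x \<and> x \<le> B \<and> h x \<le> y \<and> y \<le> h B}" using xy True by simp
      fix x y assume "(x, y) \<in> {(x, y). A \<le> x \<and> x \<le> B \<and> h x \<le> y \<and> y \<le> h B}"
      then have "A \<le> x" "x \<le> B" "h x \<le> y" "y \<le> h B" by auto
      with hAB[of x] box show "\<bar>x\<bar> \<le> R \<and> \<bar>y\<bar> \<le> R" by (auto simp: abs_le_iff)
      with H[of x y] N[of x y]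
      show "\<bar>partial (1, 0) (partial (0, 1) d) (x, y)\<bar> \<le> \<mu>\<^sup>2 / 2 * \<bar>d (x, y)\<bar>" "\<bar>d (x, y)\<bar> \<le> N"
        by simp_all
    qed (use \<mu> data in auto)
  next
    case False
    \<comment> \<open>The point reflection maps the region below the curve to the region above the reflected one.\<close>
    have neg: "((\<lambda>t. g (- t)) has_real_derivative - g' (- t)) (at t)"
      if "\<And>t. (g has_real_derivative g' t) (at t)" for g g' :: "real \<Rightarrow> real" and t
      using DERIV_chain'[OF DERIV_minus[OF DERIV_ident] that[of "- t"]] by simp
    have "\<bar>d (- (- x), - (- y))\<bar> \<le> 2 * (1 + 2 * R) * exp (4 * \<mu> * R) * \<delta>"
    proof (rule goursat_above_curve[where d = "\<lambda>x y. d (- x, - y)" and e = "\<lambda>x y. - partial (0, 1) d (- x, - y)"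
          and H = "\<lambda>x y. partial (1, 0) (partial (0, 1) d) (- x, - y)"
          and h = "\<lambda>x. - h (- x)" and A = "- B" and B = "- A" and R = R])
      show "((\<lambda>y. d (- x, - y)) has_real_derivative - partial (0, 1) d (- x, - y)) (at y)" for x y
        using neg[OF dy] .
      have "((\<lambda>x. partial (0, 1) d (x, y)) has_real_derivative partial (1, 0) (partial (0, 1) d) (x, y)) (at x)"
        for x y by (rule dx) (simp add: Basis_real_prod)
      \<comment> \<open>Each reflected variable contributes one sign, so the mixed derivative keeps
        its own.\<close>
      from DERIV_minus[OF neg[OF this]]
      show "((\<lambda>x. - partial (0, 1) d (- x, - y)) has_real_derivative
          partial (1, 0) (partial (0, 1) d) (- x, - y)) (at x)" for x y by simp
      show "mono (\<lambda>x. - h (- x))" using mono by (simp add: mono_def)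
      show "\<exists>s. - h (- s) = y" for y
      proof -
        obtain t where "- y = h t" using h(2) by (metis surj_def)
        then show ?thesis by (intro exI[of _ "- t"]) simp
      qed
      show "(- x, - y) \<in> {(x, y). - B \<le> x \<and> x \<le> - A \<and> - h (- x) \<le> y \<and> y \<le> - h (- (- A))}"
        using xy False by simp
      show "\<bar>- partial (0, 1) d (- x, - (- h (- x)))\<bar> \<le> \<delta>" if "- B \<le> x" "x \<le> - A" for x
        using data(2)[of "- x"] that by simp
      show "\<bar>d (- x, - (- h (- x)))\<bar> \<le> \<delta>" if "- B \<le> x" "x \<le> - A" for x
        using data(1)[of "- x"] that by simp
      fix x y assume "(x, y) \<in> {(x, y). - B \<le> x \<and> x \<le> - A \<and> - h (- x) \<le> y \<and> y \<le> - h (- (- A))}"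
      then have xy: "- B \<le> x" "x \<le> - A" "- h (- x) \<le> y" "y \<le> - h A" by auto
      with hAB[of "- x"] box show *: "\<bar>x\<bar> \<le> R \<and> \<bar>y\<bar> \<le> R" by (auto simp: abs_le_iff)
      with H[of "- x" "- y"] N[of "- x" "- y"]
      show "\<bar>partial (1, 0) (partial (0, 1) d) (- x, - y)\<bar> \<le> \<mu>\<^sup>2 / 2 * \<bar>d (- x, - y)\<bar>" "\<bar>d (- x, - y)\<bar> \<le> N"
        by simp_all
    qed (use \<mu> in auto)
    then show ?thesis by simp
  qed
qed

section \<open>Propagation from the curve\<close>

lemma increment_le_on_interval:
  fixes f :: "real \<Rightarrow> real"
  assumes "\<And>t. (f has_real_derivative f' t) (at t)" "\<And>t. \<bar>t\<bar> \<le> R \<Longrightarrow> \<bar>f' t\<bar> \<le> C"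
    "\<bar>a\<bar> \<le> R" "\<bar>b\<bar> \<le> R"
  shows "\<bar>f b - f a\<bar> \<le> C * (2 * R)"
proof -
  have C: "0 \<le> C" using assms(2)[OF assms(3)] by linarith
  have "norm (f b - f a) \<le> C * norm (b - a)"
    by (rule field_differentiable_bound[of "{-R..R}" f f'])
      (use assms in \<open>auto intro: has_field_derivative_at_within simp: abs_le_iff\<close>)
  also have "\<dots> \<le> C * (2 * R)"
    using C assms(3,4) by (intro mult_left_mono) auto
  finally show ?thesis by simp
qed

text \<open>The tangential derivative is a linear relation between the two first partials, solvable
  for either one as the slope does not vanish.\<close>

lemma partial_along_graph:
  fixes g :: "real \<times> real \<Rightarrow> real"
  assumes "smooth g" "smooth h"
  shows "partial 1 (\<lambda>x. g (x, h x)) x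
    = partial (1, 0) g (x, h x) + partial 1 h x * partial (0, 1) g (x, h x)"
proof -
  have comp: "(\<lambda>x. (x, h x) \<bullet> c) = (if c = (1, 0) then (\<lambda>x. x) else h)" if "c \<in> Basis" for c
    using that by (auto simp: Basis_real_prod)
  have id: "partial 1 (\<lambda>x::real. x) x = 1"
    by (simp add: partial_bounded_linear bounded_linear_ident)
  have "partial 1 (\<lambda>x. g (x, h x)) x
      = (\<Sum>c\<in>Basis. partial c g (x, h x) * partial 1 (\<lambda>x. (x, h x) \<bullet> c) x)"
  proof (rule partial_compose(2))
    show "(\<lambda>x. (x, h x) \<bullet> c) differentiable (at x)" if "c \<in> Basis" for c
      using assms(2) by (simp add: comp[OF that] smooth_differentiable)
  qed (use assms(1) smooth_differentiable in blast)
  also have "\<dots> = partial (1, 0) g (x, h x) + partial 1 h x * partial (0, 1) g (x, h x)"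
    by (simp add: Basis_real_prod id mult.commute)
  finally show ?thesis .
qed

lemma derivs_O_graph_component:
  assumes "derivs_O k 0 h" "c \<in> Basis"
  shows "derivs_O k 0 (\<lambda>\<epsilon> x::real. (x, h \<epsilon> x :: real) \<bullet> c)"
  using assms derivs_O_fixed[OF smooth_bounded_linear[OF bounded_linear_ident], of k]
  by (auto simp: Basis_real_prod)

lemma slope_nonzero:
  assumes "admissible_curve h"
  shows "partial 1 h x \<noteq> 0"
proof -
  have "smooth h" using assms by (simp add: admissible_curve_def)
  from has_real_derivative_partial[where x = 0 and s = x and b = 1, OF smooth_differentiable[OF this]]
  have "deriv h x = partial 1 h x" by (simp add: DERIV_imp_deriv)
  then show ?thesis using assms by (auto simp: admissible_curve_def)
qed

text \<open>Equality of the generalized curves enters in the form \<open>close\<close>, so the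
  results of the locale need no quotient or seminorm.\<close>

locale perturbed_curve =
  fixes f :: "real \<Rightarrow> real" and fe :: "real \<Rightarrow> real \<Rightarrow> real"
  assumes curve: "admissible_curve f"
    and curves: "\<epsilon> \<in> {0<..1} \<Longrightarrow> admissible_curve (fe \<epsilon>)"
    and close: "0 < q \<Longrightarrow> derivs_O k q (\<lambda>\<epsilon> x. fe \<epsilon> x - f x)"
begin

lemma fixed_curve: "derivs_O k 0 (\<lambda>_. f)"
  using curve by (intro derivs_O_fixed) (simp add: admissible_curve_def)

lemma bounded_curves: "derivs_O k 0 fe"
proof -
  have "derivs_O k 0 (\<lambda>\<epsilon> x. fe \<epsilon> x - f x)"
    by (rule derivs_O_antimono[OF close[OF zero_less_one]]) simp
  from derivs_O_add[OF this fixed_curve] show ?thesis by simp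
qed

lemma smooth_curves: "\<epsilon> \<in> {0<..1} \<Longrightarrow> smooth (fe \<epsilon>)"
  using curves by (simp add: admissible_curve_def)

lemma derivs_O_trace:
  "derivs_O k q g \<Longrightarrow> derivs_O k q (\<lambda>\<epsilon> x. g \<epsilon> (x, fe \<epsilon> x))"
  by (rule derivs_O_compose[where P = "\<lambda>\<epsilon> x. (x, fe \<epsilon> x)"])
    (auto intro: derivs_O_graph_component bounded_curves)

text \<open>Measures the error made when data prescribed on the graph of \<open>f\<close> are read
  off on the graph of \<open>fe \<epsilon>\<close>.\<close>

lemma trace_difference:
  assumes "smooth g" "0 < q"
  shows "derivs_O k q (\<lambda>\<epsilon> x. g (x, fe \<epsilon> x) - g (x, f x))"
proof (rule derivs_O_compose_diff[where P = "\<lambda>\<epsilon> x. (x, fe \<epsilon> x)" and Q = "\<lambda>\<epsilon> x. (x, f x)"])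
  fix c :: "real \<times> real" assume c: "c \<in> Basis"
  show "derivs_O k 0 (\<lambda>\<epsilon> x. (x, fe \<epsilon> x) \<bullet> c)"
    by (rule derivs_O_graph_component[OF bounded_curves c])
  show "derivs_O k 0 (\<lambda>\<epsilon> x. (x, f x) \<bullet> c)"
    by (rule derivs_O_graph_component[OF fixed_curve c])
  show "derivs_O k q (\<lambda>\<epsilon> x. (x, fe \<epsilon> x) \<bullet> c - (x, f x) \<bullet> c)"
    using c close[OF assms(2)] derivs_O_zero by (auto simp: Basis_real_prod)
qed (rule assms(1))

text \<open>No lower bound on the perturbed slopes uniform in \<epsilon> is assumed. It comes from
  the slope of \<open>f\<close>, which is bounded away from 0 on compact sets, and from the slopes
  differing by O(\<epsilon>).\<close>

lemma bounded_inverse_slopes: "derivs_O k 0 (\<lambda>\<epsilon> x. inverse (partial 1 (fe \<epsilon>) x))"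
proof (rule derivs_O_inverse)
  show "derivs_O k 0 (\<lambda>\<epsilon>. partial 1 (fe \<epsilon>))"
    using derivs_O_partial[OF bounded_curves, of 1] by simp
  show "partial 1 (fe \<epsilon>) x \<noteq> 0" if "\<epsilon> \<in> {0<..1}" for \<epsilon> x
    using slope_nonzero curves[OF that] by blast
  show "locally_O 0 (\<lambda>\<epsilon> x. inverse (partial 1 (fe \<epsilon>) x))"
    unfolding locally_O_def
  proof (intro allI impI)
    fix K :: "real set"
    assume K: "compact K"
    have f: "smooth f" using curve by (simp add: admissible_curve_def)
    have "compact ((\<lambda>x. inverse (partial 1 f x)) ` K)"
      using K slope_nonzero[OF curve] f
      by (intro compact_continuous_image continuous_on_inverse smooth_continuous smooth_partial) auto
    from compact_imp_bounded[OF this]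
    obtain C' where C': "\<forall>x\<in>K. \<bar>inverse (partial 1 f x)\<bar> \<le> C'"
      by (auto simp: bounded_iff)
    define C where "C = max 1 C'"
    have C: "0 < C" "\<forall>x\<in>K. \<bar>inverse (partial 1 f x)\<bar> \<le> C" using C' by (auto simp: C_def le_max_iff_disj)
    have "locally_O 1 (\<lambda>\<epsilon>. partial 1 (\<lambda>x. fe \<epsilon> x - f x))"
      using derivs_O_locally[OF derivs_O_partial[OF close[OF zero_less_one], of 1]] by simp
    from locally_OD[OF this K]
    obtain D where D: "0 < D" "\<forall>\<^sub>F \<epsilon> in at_right 0. \<forall>x\<in>K. \<bar>partial 1 (\<lambda>x. fe \<epsilon> x - f x) x\<bar> \<le> D * \<epsilon> powr 1"
      by blast
    \<comment> \<open>Below this threshold the perturbation \<open>D * \<epsilon>\<close> uses up at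
      most half of the lower bound 1/\<open>C\<close> for the slope of \<open>f\<close>.\<close>
    have "\<forall>\<^sub>F \<epsilon> in at_right 0. \<epsilon> < 1 / (2 * C * D)"
      using C D by (intro eventually_at_right_less order_tendstoD(2)[OF tendsto_ident_at]) auto
    with D(2) eventually_unit_interval
    have "\<forall>\<^sub>F \<epsilon> in at_right 0. \<forall>x\<in>K. \<bar>inverse (partial 1 (fe \<epsilon>) x)\<bar> \<le> (2 * C) * \<epsilon> powr 0"
    proof eventually_elim
      case (elim \<epsilon>)
      show ?case
      proof
        fix x assume x: "x \<in> K"
        have "\<bar>partial 1 (fe \<epsilon>) x - partial 1 f x\<bar> \<le> D * \<epsilon>"
          using elim x partial_diff_smooth[OF smooth_curves[OF elim(2)] f, of 1] by auto
        moreover have "D * \<epsilon> \<le> 1 / (2 * C)"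
          using elim C D by (simp add: field_simps)
        moreover have "1 / C \<le> \<bar>partial 1 f x\<bar>"
        proof -
          have "1 \<le> C * \<bar>partial 1 f x\<bar>"
            using C x slope_nonzero[OF curve, of x] by (auto simp: abs_inverse field_simps)
          then show ?thesis using C by (simp add: field_simps)
        qed
        moreover have "1 / C = 1 / (2 * C) + 1 / (2 * C)" using C by (simp add: field_simps)
        ultimately have "1 / (2 * C) \<le> \<bar>partial 1 (fe \<epsilon>) x\<bar>" by linarith
        then have "inverse \<bar>partial 1 (fe \<epsilon>) x\<bar> \<le> inverse (1 / (2 * C))"
          using C by (intro le_imp_inverse_le) auto
        then show "\<bar>inverse (partial 1 (fe \<epsilon>) x)\<bar> \<le> (2 * C) * \<epsilon> powr 0"
          using elim by (simp add: abs_inverse)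
      qed
    qed
    then show "\<exists>C. \<forall>\<^sub>F \<epsilon> in at_right 0. \<forall>x\<in>K. \<bar>inverse (partial 1 (fe \<epsilon>) x)\<bar> \<le> C * \<epsilon> powr 0" by blast
  qed
qed

section \<open>Transport from the curve into fixed rectangles\<close>

lemma mono_curves: "\<epsilon> \<in> {0<..1} \<Longrightarrow> mono (fe \<epsilon>)"
  using curves strict_mono_mono by (auto simp: admissible_curve_def)

text \<open>\<open>A\<close>, \<open>B\<close> and \<open>R\<close> do not depend on \<epsilon>:
  they are chosen for \<open>f\<close> with a margin of 1, and closeness at the two points
  \<open>A\<close> and \<open>B\<close> transfers the inclusions to
  \<open>fe \<epsilon>\<close>.\<close>

lemma common_rectangle:
  fixes K :: "(real \<times> real) set"
  assumes K: "compact K"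
  obtains A B R where "A \<le> B" "-R \<le> A" "B \<le> R"
    "\<forall>\<^sub>F \<epsilon> in at_right 0. -R \<le> fe \<epsilon> A \<and> fe \<epsilon> B \<le> R \<and>
       (\<forall>x y. (x, y) \<in> K \<longrightarrow> A \<le> x \<and> x \<le> B \<and> fe \<epsilon> A \<le> y \<and> y \<le> fe \<epsilon> B)"
proof -
  obtain r where r: "\<forall>p\<in>K. norm p \<le> r"
    using compact_imp_bounded[OF K] by (auto simp: bounded_iff)
  define \<rho> where "\<rho> = max r 0"
  have \<rho>: "\<bar>x\<bar> \<le> \<rho>" "\<bar>y\<bar> \<le> \<rho>" if "(x, y) \<in> K" for x y
    using r that norm_fst_le[of x y] norm_snd_le[of y x] by (force simp: \<rho>_def)+
  have mf: "mono f" and sf: "range f = UNIV"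
    using curve strict_mono_mono by (auto simp: admissible_curve_def)
  \<comment> \<open>The extra 1 leaves room for \<open>fe \<epsilon>\<close> to differ from
    \<open>f\<close> by at most 1 at the corners.\<close>
  obtain a where a: "f a = - \<rho> - 1" using sf by (metis surj_def)
  obtain b where b: "f b = \<rho> + 1" using sf by (metis surj_def)
  define A where "A = min a (- \<rho>)"
  define B where "B = max b \<rho>"
  have fA: "f A \<le> - \<rho> - 1" using monoD[OF mf, of A a] a by (simp add: A_def)
  have fB: "\<rho> + 1 \<le> f B" using monoD[OF mf, of b B] b by (simp add: B_def)
  define R where "R = \<bar>A\<bar> + \<bar>B\<bar> + \<bar>f A\<bar> + \<bar>f B\<bar> + 1"
  have R: "\<bar>A\<bar> \<le> R" "\<bar>B\<bar> \<le> R" "\<bar>f A\<bar> + 1 \<le> R" "\<bar>f B\<bar> + 1 \<le> R" by (auto simp: R_def)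
  have "locally_O 1 (\<lambda>\<epsilon> x. fe \<epsilon> x - f x)"
    using derivs_O_locally[OF close[OF zero_less_one]] .
  from locally_OD[OF this, of "{A, B}"]
  obtain C where C: "0 < C" "\<forall>\<^sub>F \<epsilon> in at_right 0. \<forall>x\<in>{A, B}. \<bar>fe \<epsilon> x - f x\<bar> \<le> C * \<epsilon> powr 1"
    by auto
  have "\<forall>\<^sub>F \<epsilon> in at_right 0. \<epsilon> < 1 / C"
    using C by (intro order_tendstoD(2)[OF tendsto_ident_at]) auto
  with C(2) eventually_unit_interval
  have "\<forall>\<^sub>F \<epsilon> in at_right 0. -R \<le> fe \<epsilon> A \<and> fe \<epsilon> B \<le> R \<and>
       (\<forall>x y. (x, y) \<in> K \<longrightarrow> A \<le> x \<and> x \<le> B \<and> fe \<epsilon> A \<le> y \<and> y \<le> fe \<epsilon> B)"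
  proof eventually_elim
    case (elim \<epsilon>)
    have "C * \<epsilon> \<le> 1" using elim C by (simp add: field_simps)
    then have *: "\<bar>fe \<epsilon> A - f A\<bar> \<le> 1" "\<bar>fe \<epsilon> B - f B\<bar> \<le> 1" using elim by auto
    have "A \<le> x \<and> x \<le> B \<and> fe \<epsilon> A \<le> y \<and> y \<le> fe \<epsilon> B" if "(x, y) \<in> K" for x y
    proof -
      have "A \<le> - \<rho>" "\<rho> \<le> B" by (auto simp: A_def B_def)
      with \<rho>[OF that] * fA fB show ?thesis by linarith
    qed
    moreover have "-R \<le> fe \<epsilon> A" "fe \<epsilon> B \<le> R" using * R by linarith+
    ultimately show ?case by blast
  qed
  moreover have "A \<le> B" by (auto simp: A_def B_def \<rho>_def)
  moreover have "-R \<le> A" "B \<le> R" using R by linarith+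
  ultimately show ?thesis using that by blast
qed

text \<open>From a point of the rectangle the curve is reached along either coordinate direction
  inside the square of half-width \<open>R\<close>. The increment is then the partial in that
  direction times a bounded length.\<close>

lemma locally_O_from_trace:
  assumes g: "\<And>\<epsilon>. \<epsilon> \<in> {0<..1} \<Longrightarrow> smooth (g \<epsilon>)"
    and tr: "locally_O q (\<lambda>\<epsilon> x. g \<epsilon> (x, fe \<epsilon> x))"
    and b: "b \<in> Basis" "locally_O q (\<lambda>\<epsilon>. partial b (g \<epsilon>))"
  shows "locally_O q g"
  unfolding locally_O_def
proof (intro allI impI)
  fix K :: "(real \<times> real) set"
  assume "compact K"
  from common_rectangle[OF this]
  obtain A B R where AB: "A \<le> B" "-R \<le> A" "B \<le> R" and ev:
    "\<forall>\<^sub>F \<epsilon> in at_right 0. -R \<le> fe \<epsilon> A \<and> fe \<epsilon> B \<le> R \<and>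
       (\<forall>x y. (x, y) \<in> K \<longrightarrow> A \<le> x \<and> x \<le> B \<and> fe \<epsilon> A \<le> y \<and> y \<le> fe \<epsilon> B)" by blast
  obtain C where C: "\<forall>\<^sub>F \<epsilon> in at_right 0. \<forall>x\<in>{A..B}. \<bar>g \<epsilon> (x, fe \<epsilon> x)\<bar> \<le> C * \<epsilon> powr q"
    using locally_OD[OF tr compact_Icc] by blast
  obtain D where D: "\<forall>\<^sub>F \<epsilon> in at_right 0. \<forall>p\<in>{-R..R} \<times> {-R..R}. \<bar>partial b (g \<epsilon>) p\<bar> \<le> D * \<epsilon> powr q"
    using locally_OD[OF b(2) compact_Times[OF compact_Icc compact_Icc]] by blast
  have "\<forall>\<^sub>F \<epsilon> in at_right 0. \<forall>p\<in>K. \<bar>g \<epsilon> p\<bar> \<le> (C + 2 * R * D) * \<epsilon> powr q"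
    using ev C D eventually_unit_interval
  proof eventually_elim
    case (elim \<epsilon>)
    note sg = g[OF elim(4)]
    have D': "\<bar>partial b (g \<epsilon>) (x, y)\<bar> \<le> D * \<epsilon> powr q" if "\<bar>x\<bar> \<le> R" "\<bar>y\<bar> \<le> R" for x y
      using elim(3) that by (auto simp: abs_le_iff)
    show ?case
    proof
      fix p assume p: "p \<in> K"
      obtain x y where xy: "p = (x, y)" by (cases p)
      have box: "A \<le> x" "x \<le> B" "fe \<epsilon> A \<le> y" "y \<le> fe \<epsilon> B" "-R \<le> fe \<epsilon> A" "fe \<epsilon> B \<le> R"
        using elim(1) p xy by auto
      have "\<exists>s. A \<le> s \<and> s \<le> B \<and> \<bar>g \<epsilon> (x, y) - g \<epsilon> (s, fe \<epsilon> s)\<bar> \<le> D * \<epsilon> powr q * (2 * R)"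
      proof (cases "b = (1, 0)")
        case True
        \<comment> \<open>A horizontal segment meets the curve by the intermediate value theorem;
          the vertical one ends at \<open>fe \<epsilon> x\<close> directly.\<close>
        have "continuous_on {A..B} (fe \<epsilon>)" by (rule smooth_continuous[OF smooth_curves[OF elim(4)]])
        from IVT'[OF box(3,4) AB(1) this]
        obtain s where s: "A \<le> s" "s \<le> B" "fe \<epsilon> s = y" by blast
        have "\<bar>g \<epsilon> (x, y) - g \<epsilon> (s, y)\<bar> \<le> D * \<epsilon> powr q * (2 * R)"
          by (rule increment_le_on_interval[OF has_derivative_fst_var[OF sg]])
            (use D' True s box AB in \<open>auto simp: abs_le_iff\<close>)
        with s show ?thesis by auto
      next
        case False
        then have b01: "b = (0, 1)" using b(1) by (auto simp: Basis_real_prod)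
        have "fe \<epsilon> A \<le> fe \<epsilon> x" "fe \<epsilon> x \<le> fe \<epsilon> B"
          using box monoD[OF mono_curves[OF elim(4)]] by blast+
        then have "\<bar>g \<epsilon> (x, y) - g \<epsilon> (x, fe \<epsilon> x)\<bar> \<le> D * \<epsilon> powr q * (2 * R)"
          by (intro increment_le_on_interval[OF has_derivative_snd_var[OF sg]])
            (use D' b01 box AB in \<open>auto simp: abs_le_iff\<close>)
        with box show ?thesis by auto
      qed
      then obtain s where s: "A \<le> s" "s \<le> B" "\<bar>g \<epsilon> (x, y) - g \<epsilon> (s, fe \<epsilon> s)\<bar> \<le> D * \<epsilon> powr q * (2 * R)"
        by blast
      moreover have "\<bar>g \<epsilon> (s, fe \<epsilon> s)\<bar> \<le> C * \<epsilon> powr q" using elim(2) s by auto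
      ultimately have "\<bar>g \<epsilon> (x, y)\<bar> \<le> C * \<epsilon> powr q + D * \<epsilon> powr q * (2 * R)" by linarith
      then show "\<bar>g \<epsilon> p\<bar> \<le> (C + 2 * R * D) * \<epsilon> powr q" by (simp add: xy algebra_simps)
    qed
  qed
  then show "\<exists>C. \<forall>\<^sub>F \<epsilon> in at_right 0. \<forall>p\<in>K. \<bar>g \<epsilon> p\<bar> \<le> C * \<epsilon> powr q" by blast
qed

text \<open>Solves the tangential relation for the missing partial, at the price of one order of the
  trace. Recovering the y-partial divides by the slope and uses
  \<open>bounded_inverse_slopes\<close>; the converse only multiplies by it.\<close>

lemma derivs_O_trace_partials:
  assumes g: "\<And>\<epsilon>. \<epsilon> \<in> {0<..1} \<Longrightarrow> smooth (g \<epsilon>)"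
    and tr: "derivs_O (Suc k) q (\<lambda>\<epsilon> x. g \<epsilon> (x, fe \<epsilon> x))"
  shows "derivs_O k q (\<lambda>\<epsilon> x. partial (1, 0) (g \<epsilon>) (x, fe \<epsilon> x))
    \<longleftrightarrow> derivs_O k q (\<lambda>\<epsilon> x. partial (0, 1) (g \<epsilon>) (x, fe \<epsilon> x))" (is "?X \<longleftrightarrow> ?Y")
proof -
  have tr': "derivs_O k q (\<lambda>\<epsilon>. partial 1 (\<lambda>x. g \<epsilon> (x, fe \<epsilon> x)))"
    using derivs_O_partial[OF tr, of 1] by simp
  have slopes: "derivs_O k 0 (\<lambda>\<epsilon>. partial 1 (fe \<epsilon>))"
    using derivs_O_partial[OF bounded_curves, of 1] by simp
  show ?thesis
  proof
    assume ?X
    show ?Y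
    proof (rule derivs_O_cong)
      show "derivs_O k q (\<lambda>\<epsilon> x. inverse (partial 1 (fe \<epsilon>) x)
          * (partial 1 (\<lambda>x. g \<epsilon> (x, fe \<epsilon> x)) x - partial (1, 0) (g \<epsilon>) (x, fe \<epsilon> x)))"
        by (intro derivs_O_bounded_mult bounded_inverse_slopes derivs_O_diff tr' \<open>?X\<close>)
      show "(\<lambda>x. inverse (partial 1 (fe \<epsilon>) x)
          * (partial 1 (\<lambda>x. g \<epsilon> (x, fe \<epsilon> x)) x - partial (1, 0) (g \<epsilon>) (x, fe \<epsilon> x)))
          = (\<lambda>x. partial (0, 1) (g \<epsilon>) (x, fe \<epsilon> x))" if e: "\<epsilon> \<in> {0<..1}" for \<epsilon>
        using slope_nonzero[OF curves[OF e]]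
        by (simp add: partial_along_graph[OF g[OF e] smooth_curves[OF e]] fun_eq_iff)
    qed
  next
    assume ?Y
    show ?X
    proof (rule derivs_O_cong)
      show "derivs_O k q (\<lambda>\<epsilon> x. partial 1 (\<lambda>x. g \<epsilon> (x, fe \<epsilon> x)) x
          - partial 1 (fe \<epsilon>) x * partial (0, 1) (g \<epsilon>) (x, fe \<epsilon> x))"
        by (intro derivs_O_bounded_mult slopes derivs_O_diff tr' \<open>?Y\<close>)
      show "(\<lambda>x. partial 1 (\<lambda>x. g \<epsilon> (x, fe \<epsilon> x)) x
          - partial 1 (fe \<epsilon>) x * partial (0, 1) (g \<epsilon>) (x, fe \<epsilon> x))
          = (\<lambda>x. partial (1, 0) (g \<epsilon>) (x, fe \<epsilon> x))" if e: "\<epsilon> \<in> {0<..1}" for \<epsilon>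
        by (simp add: partial_along_graph[OF g[OF e] smooth_curves[OF e]] fun_eq_iff)
    qed
  qed
qed

text \<open>Every first partial of \<open>g\<close> satisfies the same hypotheses one order lower:
  its trace is controlled by \<open>derivs_O_trace_partials\<close>, and its partial in direction
  \<open>b\<close> by commuting derivatives. This closes the induction on \<open>k\<close>.\<close>

lemma derivs_O_from_trace:
  assumes "\<And>\<epsilon>. \<epsilon> \<in> {0<..1} \<Longrightarrow> smooth (g \<epsilon>)"
    and "derivs_O k q (\<lambda>\<epsilon> x. g \<epsilon> (x, fe \<epsilon> x))"
    and b: "b \<in> Basis" and "derivs_O k q (\<lambda>\<epsilon>. partial b (g \<epsilon>))"
  shows "derivs_O k q g"
  using assms(1,2,4)
proof (induction k arbitrary: g)
  case 0
  then show ?case using locally_O_from_trace[OF _ _ b, of g q] by auto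
next
  case (Suc k)
  note g = Suc.prems(1) and tr = Suc.prems(2) and pb = Suc.prems(3)
  have "derivs_O k q (\<lambda>\<epsilon> x. partial b (g \<epsilon>) (x, fe \<epsilon> x))"
    by (rule derivs_O_trace[OF derivs_O_SucD[OF pb]])
  \<comment> \<open>For \<open>c = b\<close> this is the restriction just made; the other direction
    comes from the tangential relation.\<close>
  then have trp: "derivs_O k q (\<lambda>\<epsilon> x. partial c (g \<epsilon>) (x, fe \<epsilon> x))" if "c \<in> Basis" for c
    using derivs_O_trace_partials[OF g tr] b that by (auto simp: Basis_real_prod)
  have "derivs_O k q (\<lambda>\<epsilon>. partial c (g \<epsilon>))" if c: "c \<in> Basis" for c
  proof (rule Suc.IH)
    show "smooth (partial c (g \<epsilon>))" if "\<epsilon> \<in> {0<..1}" for \<epsilon>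
      using g[OF that] c by (rule smooth_partial)
    show "derivs_O k q (\<lambda>\<epsilon> x. partial c (g \<epsilon>) (x, fe \<epsilon> x))" by (rule trp[OF c])
    show "derivs_O k q (\<lambda>\<epsilon>. partial b (partial c (g \<epsilon>)))"
      by (rule derivs_O_cong[OF derivs_O_partial[OF pb c]])
        (simp add: partial_commute[OF g b c])
  qed
  moreover have "locally_O q g"
    by (rule locally_O_from_trace[OF g derivs_O_locally[OF tr] b derivs_O_locally[OF pb]])
  ultimately show ?case using g by simp
qed

text \<open>A bootstrap: order \<open>k\<close> of \<open>d\<close> gives order \<open>k\<close> of
  the mixed derivative, and integrating it from the curve in either direction gives order
  \<open>k\<close> of both first partials. Traces are assumed at every order because recovering that
  of the x-partial loses one.\<close>

theorem derivs_O_cauchy_problem: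
  assumes d: "\<And>\<epsilon>. \<epsilon> \<in> {0<..1} \<Longrightarrow> smooth (d \<epsilon>)"
    and base: "derivs_O 0 q d"
    and tr: "\<And>k. derivs_O k q (\<lambda>\<epsilon> x. d \<epsilon> (x, fe \<epsilon> x))"
      "\<And>k. derivs_O k q (\<lambda>\<epsilon> x. partial (0, 1) (d \<epsilon>) (x, fe \<epsilon> x))"
    and rhs: "\<And>k. derivs_O k q d \<Longrightarrow> derivs_O k q (\<lambda>\<epsilon>. partial (1, 0) (partial (0, 1) (d \<epsilon>)))"
  shows "derivs_O k q d"
proof (induction k)
  case (Suc k)
  have B: "(1, 0) \<in> (Basis :: (real \<times> real) set)" "(0, 1) \<in> (Basis :: (real \<times> real) set)"
    by (auto simp: Basis_real_prod)
  have "derivs_O k q (\<lambda>\<epsilon>. partial (0, 1) (d \<epsilon>))"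
    by (rule derivs_O_from_trace[OF smooth_partial[OF d B(2)] tr(2) B(1) rhs[OF Suc]])
  moreover have "derivs_O k q (\<lambda>\<epsilon>. partial (1, 0) (d \<epsilon>))"
  proof (rule derivs_O_from_trace[OF smooth_partial[OF d B(1)] _ B(2)])
    \<comment> \<open>The Cauchy data prescribe only the y-partial; the x-partial on the curve
      follows from the tangential derivative of the first datum.\<close>
    show "derivs_O k q (\<lambda>\<epsilon> x. partial (1, 0) (d \<epsilon>) (x, fe \<epsilon> x))"
      using derivs_O_trace_partials[OF d tr(1)] tr(2) by simp
    show "derivs_O k q (\<lambda>\<epsilon>. partial (0, 1) (partial (1, 0) (d \<epsilon>)))"
      by (rule derivs_O_cong[OF rhs[OF Suc]]) (simp add: partial_commute[OF d B])
  qed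
  ultimately show ?case
    using d derivs_O_locally[OF base] by (auto simp: Basis_real_prod)
qed (rule base)

end

section \<open>Stability under perturbation of the curve\<close>

text \<open>The bound on the derivative is uniform in the last variable, so the estimate is global
  in \<open>a\<close> and \<open>b\<close> and requires no prior bound on the perturbed
  solutions.\<close>

lemma Lipschitz_in_last_variable:
  fixes F :: "real \<times> real \<times> real \<Rightarrow> real"
  assumes F: "smooth F"
    and L: "\<And>z. \<bar>partial (0, 0, 1) F (x, y, z)\<bar> \<le> L"
  shows "\<bar>F (x, y, a) - F (x, y, b)\<bar> \<le> L * \<bar>a - b\<bar>"
proof -
  have "((\<lambda>z. F (x, y, z)) has_real_derivative partial (0, 0, 1) F (x, y, z)) (at z)" for z
    using has_real_derivative_partial[where x = "(x, y, 0)" and s = z and b = "(0, 0, 1)",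
        OF smooth_differentiable[OF F]] by simp
  then have "norm (F (x, y, a) - F (x, y, b)) \<le> L * norm (a - b)"
    by (intro field_differentiable_bound[of UNIV "\<lambda>z. F (x, y, z)"]) (auto simp: L)
  then show ?thesis by simp
qed

text \<open>As \<open>q\<close> is nonnegative, \<open>u\<close> is \<open>v\<close> plus a bounded
  family; both arguments of \<open>F\<close> then have bounded derivatives and differ by order
  \<open>q\<close>, as \<open>derivs_O_compose_diff\<close> demands.\<close>

lemma derivs_O_nonlinear_difference:
  fixes F :: "real \<times> real \<times> real \<Rightarrow> real" and u :: "real \<Rightarrow> real \<times> real \<Rightarrow> real"
  assumes F: "smooth F" and v: "smooth v" and q: "0 \<le> q"
    and uv: "derivs_O k q (\<lambda>\<epsilon> p. u \<epsilon> p - v p)"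
  shows "derivs_O k q (\<lambda>\<epsilon> p. F (fst p, snd p, u \<epsilon> p) - F (fst p, snd p, v p))"
proof (rule derivs_O_compose_diff[where P = "\<lambda>\<epsilon> p. (fst p, snd p, u \<epsilon> p)"
      and Q = "\<lambda>\<epsilon> p. (fst p, snd p, v p)", OF F])
  have v0: "derivs_O k 0 (\<lambda>_. v)" using v by (rule derivs_O_fixed)
  have u0: "derivs_O k 0 u"
    using derivs_O_add[OF derivs_O_antimono[OF uv q] v0] by simp
  have coords: "derivs_O k 0 (\<lambda>_. fst :: real \<times> real \<Rightarrow> real)" "derivs_O k 0 (\<lambda>_. snd :: real \<times> real \<Rightarrow> real)"
    by (intro derivs_O_fixed smooth_bounded_linear bounded_linear_fst bounded_linear_snd)+
  fix c :: "real \<times> real \<times> real" assume "c \<in> Basis"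
  then have c: "c = (1, 0, 0) \<or> c = (0, 1, 0) \<or> c = (0, 0, 1)"
    by (auto simp: Basis_prod_def zero_prod_def)
  show "derivs_O k 0 (\<lambda>\<epsilon> p. (fst p, snd p, u \<epsilon> p) \<bullet> c)"
    using c coords u0 by auto
  show "derivs_O k 0 (\<lambda>\<epsilon> p. (fst p, snd p, v p) \<bullet> c)"
    using c coords v0 by auto
  show "derivs_O k q (\<lambda>\<epsilon> p. (fst p, snd p, u \<epsilon> p) \<bullet> c - (fst p, snd p, v p) \<bullet> c)"
    using c derivs_O_zero uv by auto
qed

theorem theorem24:
  fixes F :: "real \<times> real \<times> real \<Rightarrow> real"
    and f \<phi> \<psi> :: "real \<Rightarrow> real"
    and v :: "real \<times> real \<Rightarrow> real"
    and fe :: "real \<Rightarrow> real \<Rightarrow> real"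
    and u :: "real \<Rightarrow> real \<times> real \<Rightarrow> real"
  assumes "smooth F"
    and "\<And>K :: (real \<times> real) set. compact K \<Longrightarrow>
           bdd_above {\<bar>partial (0, 0, 1) F (x, y, z)\<bar> | x y z. (x, y) \<in> K}"
    and "admissible_curve f"
    and "smooth \<phi>" and "smooth \<psi>"
    and "classical_solution F f \<phi> \<psi> v"
    and "fe \<in> moderate"
    and "gclass fe = gclass (\<lambda>_. f)"
    and "\<And>\<epsilon>. \<epsilon> \<in> {0<..1} \<Longrightarrow> admissible_curve (fe \<epsilon>)"
    and "\<And>\<epsilon>. \<epsilon> \<in> {0<..1} \<Longrightarrow> classical_solution F (fe \<epsilon>) \<phi> \<psi> (u \<epsilon>)"
  shows "u \<in> moderate \<and> gclass u = gclass (\<lambda>_. v)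
           \<and> (\<lambda>\<epsilon> p. u \<epsilon> p - v p) \<in> null_families"
proof -
  note F = assms(1)
  have v: "smooth v" and v_eq: "\<And>x y. partial (1, 0) (partial (0, 1) v) (x, y) = F (x, y, v (x, y))"
    and v_data: "\<And>x. v (x, f x) = \<phi> x" "\<And>x. partial (0, 1) v (x, f x) = \<psi> x"
    using assms(6) unfolding classical_solution_def by blast+
  have u: "smooth (u \<epsilon>)"
    and u_eq: "\<And>x y. partial (1, 0) (partial (0, 1) (u \<epsilon>)) (x, y) = F (x, y, u \<epsilon> (x, y))"
    and u_data: "\<And>x. u \<epsilon> (x, fe \<epsilon> x) = \<phi> x" "\<And>x. partial (0, 1) (u \<epsilon>) (x, fe \<epsilon> x) = \<psi> x"
    if "\<epsilon> \<in> {0<..1}" for \<epsilon>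
    using assms(10)[OF that] unfolding classical_solution_def by blast+
  interpret perturbed_curve f fe
  proof
    show "derivs_O k q (\<lambda>\<epsilon> x. fe \<epsilon> x - f x)" if "0 < q" for k q
      using null_imp_derivs_O[OF gclass_eqD[OF assms(8,7)] that] .
  qed (use assms in auto)
  have B: "(1, 0) \<in> (Basis :: (real \<times> real) set)" "(0, 1) \<in> (Basis :: (real \<times> real) set)"
    by (auto simp: Basis_real_prod)
  have vy: "smooth (partial (0, 1) v)" using v B by (intro smooth_partial)
  define d where "d = (\<lambda>\<epsilon> p. u \<epsilon> p - v p)"
  have d: "smooth (d \<epsilon>)" if "\<epsilon> \<in> {0<..1}" for \<epsilon>
    unfolding d_def using u[OF that] v by (rule smooth_diff)
  have d_y: "partial (0, 1) (d \<epsilon>) = (\<lambda>p. partial (0, 1) (u \<epsilon>) p - partial (0, 1) v p)"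
    if "\<epsilon> \<in> {0<..1}" for \<epsilon>
    unfolding d_def using u[OF that] v by (rule partial_diff_smooth)
  have d_xy: "partial (1, 0) (partial (0, 1) (d \<epsilon>))
      = (\<lambda>p. F (fst p, snd p, u \<epsilon> p) - F (fst p, snd p, v p))" if e: "\<epsilon> \<in> {0<..1}" for \<epsilon>
    unfolding d_y[OF e] partial_diff_smooth[OF smooth_partial[OF u[OF e] B(2)] vy]
    using u_eq[OF e] v_eq by (auto simp: fun_eq_iff)
  have main: "derivs_O k q d" if q: "0 < q" for k q
  proof (rule derivs_O_cauchy_problem)
    \<comment> \<open>On the graph of \<open>fe \<epsilon>\<close> the solution
      \<open>u \<epsilon>\<close> equals \<phi>, which is \<open>v\<close> on the graph of
      \<open>f\<close>. So the trace of \<open>d\<close> is a difference of traces of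
      \<open>v\<close>, with the opposite sign to \<open>trace_difference\<close>; likewise for the
      y-partial.\<close>
    show tr1: "derivs_O k q (\<lambda>\<epsilon> x. d \<epsilon> (x, fe \<epsilon> x))" for k
      by (rule derivs_O_cong[OF derivs_O_minus[OF trace_difference[OF v q]]])
        (simp add: d_def u_data v_data)
    show tr2: "derivs_O k q (\<lambda>\<epsilon> x. partial (0, 1) (d \<epsilon>) (x, fe \<epsilon> x))" for k
      by (rule derivs_O_cong[OF derivs_O_minus[OF trace_difference[OF vy q]]])
        (simp add: d_y u_data v_data)
    show "derivs_O k q (\<lambda>\<epsilon>. partial (1, 0) (partial (0, 1) (d \<epsilon>)))" if "derivs_O k q d" for k
      by (rule derivs_O_cong[OF derivs_O_nonlinear_difference[OF F v less_imp_le[OF q]]])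
        (use that d_xy in \<open>auto simp: d_def\<close>)
    have "locally_O q d"
      unfolding locally_O_def
    proof (intro allI impI)
      fix K :: "(real \<times> real) set"
      assume "compact K"
      from common_rectangle[OF this]
      obtain A B R where AB: "A \<le> B" "-R \<le> A" "B \<le> R" and ev:
        "\<forall>\<^sub>F \<epsilon> in at_right 0. -R \<le> fe \<epsilon> A \<and> fe \<epsilon> B \<le> R \<and>
           (\<forall>x y. (x, y) \<in> K \<longrightarrow> A \<le> x \<and> x \<le> B \<and> fe \<epsilon> A \<le> y \<and> y \<le> fe \<epsilon> B)" by blast
      obtain C where C: "0 < C" "\<forall>\<^sub>F \<epsilon> in at_right 0. \<forall>x\<in>{A..B}. \<bar>d \<epsilon> (x, fe \<epsilon> x)\<bar> \<le> C * \<epsilon> powr q"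
        using locally_OD[OF derivs_O_locally[OF tr1] compact_Icc] by blast
      obtain D where D: "0 < D"
        "\<forall>\<^sub>F \<epsilon> in at_right 0. \<forall>x\<in>{A..B}. \<bar>partial (0, 1) (d \<epsilon>) (x, fe \<epsilon> x)\<bar> \<le> D * \<epsilon> powr q"
        using locally_OD[OF derivs_O_locally[OF tr2] compact_Icc] by blast
      obtain L0 where L0: "\<And>x y z. (x, y) \<in> {-R..R} \<times> {-R..R} \<Longrightarrow> \<bar>partial (0, 0, 1) F (x, y, z)\<bar> \<le> L0"
        using assms(2)[OF compact_Times[OF compact_Icc compact_Icc], of "-R" R "-R" R]
        unfolding bdd_above_def by blast
      \<comment> \<open>The added 1 makes the Lipschitz constant positive, hence also \<mu>, which
        is chosen so that \<open>\<mu>\<^sup>2 / 2 = L\<close>.\<close>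
      define L where "L = \<bar>L0\<bar> + 1"
      define \<mu> where "\<mu> = sqrt (2 * L)"
      have \<mu>: "0 < \<mu>" "\<mu>\<^sup>2 / 2 = L" by (simp_all add: \<mu>_def L_def)
      have L: "\<bar>F (x, y, a) - F (x, y, b)\<bar> \<le> L * \<bar>a - b\<bar>" if "\<bar>x\<bar> \<le> R" "\<bar>y\<bar> \<le> R" for x y a b
      proof (rule Lipschitz_in_last_variable[OF F])
        fix z
        have "\<bar>partial (0, 0, 1) F (x, y, z)\<bar> \<le> L0" using that by (intro L0) (auto simp: abs_le_iff)
        then show "\<bar>partial (0, 0, 1) F (x, y, z)\<bar> \<le> L" by (simp add: L_def)
      qed
      have "\<forall>\<^sub>F \<epsilon> in at_right 0. \<forall>p\<in>K. \<bar>d \<epsilon> p\<bar>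
          \<le> (2 * (1 + 2 * R) * exp (4 * \<mu> * R) * (C + D)) * \<epsilon> powr q"
        using ev C(2) D(2) eventually_unit_interval
      proof eventually_elim
        case (elim \<epsilon>)
        note e = elim(4)
        have adm: "strict_mono (fe \<epsilon>)" "range (fe \<epsilon>) = UNIV"
          using curves[OF e] by (auto simp: admissible_curve_def)
        \<comment> \<open>The estimate takes a single bound for both data, so the two constants are
          added.\<close>
        have CD: "C * \<epsilon> powr q \<le> (C + D) * \<epsilon> powr q" "D * \<epsilon> powr q \<le> (C + D) * \<epsilon> powr q"
          using C D by (auto intro!: mult_right_mono)
        show ?case
        proof
          fix p assume p: "p \<in> K"
          obtain x y where xy: "p = (x, y)" by (cases p)
          have "\<bar>d \<epsilon> (x, y)\<bar> \<le> 2 * (1 + 2 * R) * exp (4 * \<mu> * R) * ((C + D) * \<epsilon> powr q)"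
          proof (rule goursat_estimate[OF d[OF e] adm])
            show "\<bar>partial (1, 0) (partial (0, 1) (d \<epsilon>)) (x, y)\<bar> \<le> \<mu>\<^sup>2 / 2 * \<bar>d \<epsilon> (x, y)\<bar>"
              if "\<bar>x\<bar> \<le> R" "\<bar>y\<bar> \<le> R" for x y
              unfolding d_xy[OF e] \<mu>(2) using L[OF that] by (simp add: d_def)
            show "\<bar>d \<epsilon> (x, fe \<epsilon> x)\<bar> \<le> (C + D) * \<epsilon> powr q" if "A \<le> x" "x \<le> B" for x
              using elim(2) CD that by force
            show "\<bar>partial (0, 1) (d \<epsilon>) (x, fe \<epsilon> x)\<bar> \<le> (C + D) * \<epsilon> powr q" if "A \<le> x" "x \<le> B" for x
              using elim(3) CD that by force
          qed (use AB \<mu> elim(1) p xy in auto)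
          then show "\<bar>d \<epsilon> p\<bar> \<le> (2 * (1 + 2 * R) * exp (4 * \<mu> * R) * (C + D)) * \<epsilon> powr q"
            by (simp add: xy mult.assoc)
        qed
      qed
      then show "\<exists>C. \<forall>\<^sub>F \<epsilon> in at_right 0. \<forall>p\<in>K. \<bar>d \<epsilon> p\<bar> \<le> C * \<epsilon> powr q" by blast
    qed
    then show "derivs_O 0 q d" using d by simp
  qed (rule d)
  then have null: "(\<lambda>\<epsilon> p. u \<epsilon> p - v p) \<in> null_families"
    unfolding d_def by (rule derivs_O_imp_null)
  have v0: "derivs_O k 0 (\<lambda>_. v)" for k using v by (rule derivs_O_fixed)
  \<comment> \<open>Moderateness of \<open>u\<close> comes from the result: \<open>u\<close> is
    \<open>v\<close> plus a family with locally bounded derivatives.\<close>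
  have "derivs_O k 0 d" for k by (rule derivs_O_antimono[OF main[OF zero_less_one]]) simp
  from derivs_O_add[OF this v0] have "derivs_O k 0 u" for k by (simp add: d_def)
  then have "u \<in> moderate" by (rule derivs_O_imp_moderate)
  moreover have "(\<lambda>_. v) \<in> moderate" using v0 by (rule derivs_O_imp_moderate)
  ultimately show ?thesis using null gclass_eqI[of u "\<lambda>_. v"] by simp
qed

end
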